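(* Let $\varphi$ be an absolute norm on $\mathbb R^2$ and let $\alpha>0$ be such that $\alpha\notin\Lambda^\varphi$. Then the minimization problem $$\min\{\mathcal F_\alpha^\varphi(E,q): E\in\mathcal D,\ E\supset q\}$$ has a unique solution $E_\alpha^1$, and it satisfies $$E_\alpha^1=E\big(\mathbb Z_e^2\cap B_{4/\alpha}^\varphi\big).$$ In particular, $E_\alpha^1\in\mathcal A^e_{\rm conv}$.
   Context: A norm $\varphi$ on $\mathbb R^2$ is absolute if $\varphi(\mathbf x)$ depends only on $|x_1|,|x_2|$. $B_r^\varphi=\{\mathbf x:\varphi(\mathbf x)<r\}$. $q(\mathbf x)=\mathbf x+[-\frac12,\frac12]^2$, $q=q(0)$. For $\mathcal I\subset\mathbb Z^2$, $E(\mathcal I)=\bigcup_{\mathbf i\in\mathcal I}q(\mathbf i)$; $\mathcal D$ is the class of all such sets and $Z(E)=E\cap\mathbb Z^2$ for $E\in\mathcal D$. Energies are considered on sets of finite perimeter. $\mathbb Z_e^2=\{\mathbf i\in\mathbb Z^2:i_1+i_2\in2\mathbb Z\}$ and $\Lambda^\varphi=\{4/\varphi(\mathbf i):\mathbf i\in\mathbb Z_e^2\setminus\{(0,0)\}\}$. $\mathcal A^e_{\rm conv}$ is the class of $E\in\mathcal D$ with $Z(E)\subset\mathbb Z_e^2$ and $\operatorname{conv}(Z(E))\cap\mathbb Z_e^2=Z(E)$. For $E,F\in\mathcal D$, $$\mathcal F_\alpha^\varphi(E,F)=-\mathcal H^1(\partial E)+\alpha\sum_{\mathbf i\in Z(E)\triangle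 Z(F)}d^\varphi(\mathbf i,\partial F),$$ where $d^\varphi(\mathbf i,\partial F)=\inf\{\varphi(\mathbf i-\mathbf j):\mathbf j\in Z(F)\}$ if $\mathbf i\notin Z(F)$ and $=\inf\{\varphi(\mathbf i-\mathbf j):\mathbf j\in\mathbb Z^2\setminus Z(F)\}$ if $\mathbf i\in Z(F)$. *)

theory Defs
  imports "HOL-Analysis.Analysis"
begin

definition absolute_norm :: "(real^2 \<Rightarrow> real) \<Rightarrow> bool" where
  "absolute_norm \<phi> \<longleftrightarrow>
     (\<forall>x. 0 \<le> \<phi> x) \<and> (\<forall>x. \<phi> x = 0 \<longleftrightarrow> x = 0) \<and>
     (\<forall>c x. \<phi> (c *\<^sub>R x) = \<bar>c\<bar> * \<phi> x) \<and>
     (\<forall>x y. \<phi> (x + y) \<le> \<phi> x + \<phi> y) \<and>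
     (\<forall>x y. \<bar>x$1\<bar> = \<bar>y$1\<bar> \<and> \<bar>x$2\<bar> = \<bar>y$2\<bar> \<longrightarrow> \<phi> x = \<phi> y)"

definition norm_ball :: "(real^2 \<Rightarrow> real) \<Rightarrow> real \<Rightarrow> (real^2) set" where
  "norm_ball \<phi> r = {x. \<phi> x < r}"


text \<open>One-dimensional Hausdorff measure. The covering sets are required to be bounded because
  \<open>diameter\<close> has no meaningful value on unbounded sets; note \<open>diameter {} = 0\<close>.\<close>

definition hausdorff1_pre :: "real \<Rightarrow> 'a::metric_space set \<Rightarrow> ennreal" where
  "hausdorff1_pre \<delta> A =
     (INF C \<in> {C :: nat \<Rightarrow> 'a set. A \<subseteq> (\<Union>n. C n) \<and> (\<forall>n. bounded (C n) \<and> diameter (C n) \<le> \<delta>)}.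
        \<Sum>n. ennreal (diameter (C n)))"

definition hausdorff1 :: "'a::metric_space set \<Rightarrow> ennreal" where
  "hausdorff1 A = (SUP \<delta>\<in>{0<..}. hausdorff1_pre \<delta> A)"


definition lattice2 :: "(real^2) set" where
  "lattice2 = {x. x$1 \<in> \<int> \<and> x$2 \<in> \<int>}"

definition even_lattice2 :: "(real^2) set" where
  "even_lattice2 = {x \<in> lattice2. \<exists>k::int. x$1 + x$2 = 2 * of_int k}"

definition unit_square :: "real^2 \<Rightarrow> (real^2) set" where
  "unit_square x = (\<lambda>y. x + y) ` cbox (vec (-1/2)) (vec (1/2))"

definition squares_union :: "(real^2) set \<Rightarrow> (real^2) set" where
  "squares_union I = (\<Union>i\<in>I. unit_square i)"

definition lattice_sets :: "(real^2) set set" where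
  "lattice_sets = {squares_union I | I. I \<subseteq> lattice2}"

definition centers :: "(real^2) set \<Rightarrow> (real^2) set" where
  "centers E = E \<inter> lattice2"

definition even_conv_sets :: "(real^2) set set" where
  "even_conv_sets =
     {E \<in> lattice_sets. centers E \<subseteq> even_lattice2 \<and>
        convex hull (centers E) \<inter> even_lattice2 = centers E}"


definition boundary_dist :: "(real^2 \<Rightarrow> real) \<Rightarrow> real^2 \<Rightarrow> (real^2) set \<Rightarrow> ennreal" where
  "boundary_dist \<phi> i F =
     (if i \<in> centers F then INF j \<in> lattice2 - centers F. ennreal (\<phi> (i - j))
      else INF j \<in> centers F. ennreal (\<phi> (i - j)))"

definition finite_perimeter :: "(real^2) set \<Rightarrow> bool" where
  "finite_perimeter E \<longleftrightarrow> hausdorff1 (frontier E) < \<infinity>"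

text \<open>The dissipation may be infinite: a lattice set of finite perimeter can have infinitely many
  centers. On sets of finite perimeter the value below is never of the form \<open>\<infinity> - \<infinity>\<close>.\<close>

definition energy :: "(real^2 \<Rightarrow> real) \<Rightarrow> real \<Rightarrow> (real^2) set \<Rightarrow> (real^2) set \<Rightarrow> ereal" where
  "energy \<phi> \<alpha> E F =
     - enn2ereal (hausdorff1 (frontier E)) +
     ereal \<alpha> * enn2ereal (\<Sum>\<^sub>\<infinity>i\<in>sym_diff (centers E) (centers F). boundary_dist \<phi> i F)"

definition critical_values :: "(real^2 \<Rightarrow> real) \<Rightarrow> real set" where
  "critical_values \<phi> = {4 / \<phi> i | i. i \<in> even_lattice2 - {0}}"

definition first_step_solution :: "(real^2 \<Rightarrow> real) \<Rightarrow> real \<Rightarrow> (real^2) set \<Rightarrow> bool" where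
  "first_step_solution \<phi> \<alpha> =
     is_arg_min (\<lambda>E. energy \<phi> \<alpha> E (unit_square 0))
       (\<lambda>E. E \<in> lattice_sets \<and> finite_perimeter E \<and> unit_square 0 \<subseteq> E)"

end

theory Submission
  imports Defs
begin

text \<open>For \<open>E = E(I)\<close> with \<open>I\<close> finite and containing the origin, the perimeter of \<open>E\<close> is the number of
pairs of adjacent lattice points \<open>p \<in> I\<close>, \<open>q \<notin> I\<close>. Writing \<open>w(p) = 4 - \<alpha> \<phi>(p)\<close>, minus the energy
is therefore the purely combinatorial quantity
  \<open>gain I = (\<Sum>p\<in>I. w p - number of neighbours of p in I)\<close>,
and every unordered adjacent pair inside \<open>I\<close> costs 2. For sets of even points nothing is lost, so the
best even choice collects exactly the even points with \<open>w > 0\<close>, that is, those with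
\<open>\<phi> < 4 / \<alpha>\<close>. Infinite \<open>I\<close> have infinite dissipation.

It remains to see that odd points never pay off (\<open>gain_le\<close>). Every odd point \<open>p\<close> distributes the positive
part of its weight over two even neighbours, \<open>inner_cell p\<close> and \<open>outer_cell p\<close>. Three facts suffice:
both shares are at most 2, so a share is paid for by the adjacency cost whenever the neighbour that receives
it belongs to \<open>I\<close>; the shares sum to at least \<open>w p\<close>; and no even point other than the origin
receives more than the positive part of its own weight (\<open>load_le\<close>). Off the axes the quadrant is
cut into 2 by 2 blocks whose corners closest to and farthest from the origin are even, and the last fact is
submodularity of the norm,
  \<open>\<phi>(x, y) + \<phi>(x+1, y+1) \<le> \<phi>(x+1, y) + \<phi>(x, y+1)\<close> for \<open>x, y \<ge> 0\<close>.
This holds for every absolute norm: with \<open>P = (x+1, y)\<close> and \<open>Q = (x, y+1)\<close> there are \<open>u, v\<close> in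
\<open>[0, 1]\<close> such that \<open>(x, y) = u P + v Q\<close> and \<open>(x+1, y+1) = (1-u) P + (1-v) Q\<close>. On the
axes \<open>\<phi>\<close> is linear, and each odd axis point charges both of its neighbours on the axis; the origin,
which belongs to \<open>I\<close>, absorbs the share of the first one.

For uniqueness, \<open>gain_deficit\<close> writes the difference to the optimum as a sum of nonnegative terms. If all
of them vanish and \<open>\<alpha>\<close> is not critical, an odd axis point of maximal size in \<open>I\<close> shows that
\<open>I\<close> has no odd point on the axes. An odd point of minimal size off the axes has a further even
neighbour closer to the origin, \<open>third_cell p\<close>, of positive weight: if it lies in \<open>I\<close> then an
uncharged adjacency is wasted, and otherwise its capacity is not used up, because every point that charges it
is smaller or lies on an axis. So \<open>I\<close> has no odd points at all.

The identity between perimeter and number of edges needs the one-dimensional Hausdorff measure of a finite union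
of unit segments (\<open>hausdorff1_frontier\<close>). Covering by short pieces gives the upper bound. For the lower
bound the segments are shortened slightly, which makes them uniformly separated, so that a small covering set
meets at most one of them and covers at most its diameter there.\<close>

section \<open>Measuring finitely many separated segments\<close>

lemma hausdorff1_le_card:
  fixes \<gamma> :: "'i \<Rightarrow> real \<Rightarrow> 'a::metric_space"
  assumes "finite B"
    and lip: "\<And>e s t. e \<in> B \<Longrightarrow> dist (\<gamma> e s) (\<gamma> e t) \<le> \<bar>s - t\<bar>"
    and A: "A \<subseteq> (\<Union>e\<in>B. \<gamma> e ` {0..1})"
  shows "hausdorff1 A \<le> of_nat (card B)"
  unfolding hausdorff1_def
proof (rule SUP_least)
  fix \<delta> :: real assume "\<delta> \<in> {0<..}"
  then obtain n :: nat where n: "0 < n" "inverse (real n) < \<delta>"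
    by (metis ex_inverse_of_nat_less greaterThan_iff)
  define S where "S = B \<times> {..<n}"
  have fin: "finite S" and card_S: "card S = card B * n"
    using assms(1) by (auto simp: S_def)
  obtain h where h: "bij_betw h {0..<card S} S"
    using ex_bij_betw_nat_finite[OF fin] by blast
  define C where "C k = (if k < card S
    then \<gamma> (fst (h k)) ` {real (snd (h k)) / n .. (real (snd (h k)) + 1) / n} else {})" for k
  have dist_C: "dist y z \<le> inverse n" if yz: "y \<in> C k" "z \<in> C k" for y z k
  proof -
    have k: "k < card S" using yz by (auto simp: C_def split: if_splits)
    then have "h k \<in> S" using bij_betwE[OF h] by auto
    then have e: "fst (h k) \<in> B" by (auto simp: S_def)
    let ?i = "real (snd (h k))"
    have Ck: "C k = \<gamma> (fst (h k)) ` {?i / n .. (?i + 1) / n}"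
      using k by (simp add: C_def)
    obtain s t where st: "s \<in> {?i / n .. (?i + 1) / n}" "t \<in> {?i / n .. (?i + 1) / n}"
      "y = \<gamma> (fst (h k)) s" "z = \<gamma> (fst (h k)) t"
      using yz unfolding Ck by blast
    have "(?i + 1) / n = ?i / n + inverse n" by (simp add: add_divide_distrib inverse_eq_divide)
    then have "\<bar>s - t\<bar> \<le> inverse n" using st by auto
    with lip[OF e] st show ?thesis by (meson order_trans)
  qed
  have bounded: "bounded (C k)" for k
    unfolding bounded_two_points using dist_C by blast
  have diam: "diameter (C k) \<le> inverse n" for k
  proof (cases "C k = {}")
    case False
    then show ?thesis
      unfolding diameter_def using dist_C by (auto intro!: cSUP_least)
  qed (simp add: diameter_def)
  have cover: "A \<subseteq> (\<Union>k. C k)"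
  proof
    fix y assume "y \<in> A"
    then obtain e where "e \<in> B" "y \<in> \<gamma> e ` {0..1}" using A by blast
    then obtain t where et: "e \<in> B" "0 \<le> t" "t \<le> 1" "y = \<gamma> e t" by auto
    define i where "i = (if t = 1 then n - 1 else nat \<lfloor>t * n\<rfloor>)"
    have i: "i < n \<and> real i / n \<le> t \<and> t \<le> (real i + 1) / n"
    proof (cases "t = 1")
      case True
      then show ?thesis using n by (simp add: i_def field_simps of_nat_diff)
    next
      case False
      then have "t * n < n" "0 \<le> t * n" using et n by auto
      then show ?thesis
        using n False by (auto simp: i_def pos_divide_le_eq pos_le_divide_eq; linarith)
    qed
    then have "(e, i) \<in> S" using et by (simp add: S_def)
    then have "(e, i) \<in> h ` {0..<card S}" using bij_betw_imp_surj_on[OF h] by simp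
    then obtain k where "k < card S" "h k = (e, i)" by force
    then have "y \<in> C k" using i et by (auto simp: C_def)
    then show "y \<in> (\<Union>k. C k)" by blast
  qed
  have "diameter (C k) \<le> \<delta>" for k
    using diam[of k] n(2) by linarith
  then have "hausdorff1_pre \<delta> A \<le> (\<Sum>k. ennreal (diameter (C k)))"
    unfolding hausdorff1_pre_def using cover bounded by (intro INF_lower) auto
  also have "\<dots> = (\<Sum>k<card S. ennreal (diameter (C k)))"
    by (intro suminf_finite) (auto simp: C_def diameter_def)
  also have "\<dots> \<le> (\<Sum>k<card S. ennreal (inverse n))"
    using diam by (intro sum_mono ennreal_leI)
  also have "\<dots> = of_nat (card B)"
    using n by (simp add: card_S ennreal_of_nat_eq_real_of_nat flip: ennreal_mult)
  finally show "hausdorff1_pre \<delta> A \<le> of_nat (card B)" .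
qed

lemma emeasure_preimage_le_diameter:
  fixes \<gamma> :: "real \<Rightarrow> 'a::metric_space"
  assumes "bounded C" "\<And>s t. dist (\<gamma> s) (\<gamma> t) = \<bar>s - t\<bar>" "M = {t \<in> {a..b}. \<gamma> t \<in> C}" "M \<noteq> {}"
  shows "M \<subseteq> {Inf M..Sup M}" "emeasure lborel {Inf M..Sup M} \<le> ennreal (diameter C)"
proof -
  have M: "bdd_above M" "bdd_below M"
    using assms(3) by (auto intro!: bdd_aboveI[of _ b] bdd_belowI[of _ a])
  then show "M \<subseteq> {Inf M..Sup M}" by (auto intro: cInf_lower cSup_upper)
  have "t - s \<le> diameter C" if "s \<in> M" "t \<in> M" for s t
    using diameter_bounded_bound[OF assms(1), of "\<gamma> t" "\<gamma> s"] that assms(2,3) by auto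
  then have "Sup M - diameter C \<le> s" if "s \<in> M" for s
    using that assms(4) cSup_least[of M "s + diameter C"] by (simp add: algebra_simps)
  then have "Sup M - Inf M \<le> diameter C"
    using cInf_greatest[OF assms(4), of "Sup M - diameter C"] by (simp add: algebra_simps)
  moreover have "Inf M \<le> Sup M" using M assms(4) by (rule_tac cInf_le_cSup)
  ultimately show "emeasure lborel {Inf M..Sup M} \<le> ennreal (diameter C)"
    by (simp add: ennreal_leI)
qed

text \<open>The separation hypothesis lets the segments share endpoints: the distance only has to be at least \<open>\<eta>\<close>
once pieces of length \<open>\<eta>\<close> are removed at both ends.\<close>
lemma hausdorff1_ge_card:
  fixes \<gamma> :: "'i \<Rightarrow> real \<Rightarrow> 'a::metric_space"
  assumes "finite B"
    and iso: "\<And>e s t. e \<in> B \<Longrightarrow> dist (\<gamma> e s) (\<gamma> e t) = \<bar>s - t\<bar>"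
    and sep: "\<And>e e' s t \<eta>. \<lbrakk>e \<in> B; e' \<in> B; e \<noteq> e'; 0 < \<eta>; s \<in> {\<eta>..1 - \<eta>}; t \<in> {\<eta>..1 - \<eta>}\<rbrakk>
      \<Longrightarrow> \<eta> \<le> dist (\<gamma> e s) (\<gamma> e' t)"
    and A: "\<And>e. e \<in> B \<Longrightarrow> \<gamma> e ` {0<..<1} \<subseteq> A"
  shows "of_nat (card B) \<le> hausdorff1 A"
proof -
  have pre: "ennreal (card B * (1 - 2 * \<eta>)) \<le> hausdorff1_pre (\<eta> / 2) A" if \<eta>: "0 < \<eta>" "\<eta> < 1 / 2" for \<eta> :: real
    unfolding hausdorff1_pre_def
  proof (rule INF_greatest)
    fix C :: "nat \<Rightarrow> 'a set"
    assume "C \<in> {C. A \<subseteq> (\<Union>n. C n) \<and> (\<forall>n. bounded (C n) \<and> diameter (C n) \<le> \<eta> / 2)}"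
    then have C: "A \<subseteq> (\<Union>n. C n)" "\<forall>n. bounded (C n) \<and> diameter (C n) \<le> \<eta> / 2"
      by blast+
    \<comment> \<open>\<open>M e k\<close> is the set of parameters of the shortened segment \<open>e\<close> hit by
      the \<open>k\<close>-th covering set, and \<open>J e k\<close> is the interval that it spans.\<close>
    define M :: "'i \<Rightarrow> nat \<Rightarrow> real set"
      where "M e k = {t \<in> {\<eta>..1 - \<eta>}. \<gamma> e t \<in> C k}" for e k
    define J :: "'i \<Rightarrow> nat \<Rightarrow> real set"
      where "J e k = (if M e k = {} then {} else {Inf (M e k)..Sup (M e k)})" for e k
    have J: "M e k \<subseteq> J e k" "emeasure lborel (J e k) \<le> ennreal (diameter (C k))" if "e \<in> B" for e k
      using emeasure_preimage_le_diameter[OF _ iso[OF that] M_def] C(2) by (auto simp: J_def)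
    have J_sets: "range (J e) \<subseteq> sets lborel" for e
      by (auto simp: J_def)
    have unique: "e = e'" if "e \<in> B" "e' \<in> B" "M e k \<noteq> {}" "M e' k \<noteq> {}" for e e' k
    proof (rule ccontr)
      assume "e \<noteq> e'"
      obtain s t where st: "s \<in> M e k" "t \<in> M e' k" using \<open>M e k \<noteq> {}\<close> \<open>M e' k \<noteq> {}\<close> by blast
      then have "dist (\<gamma> e s) (\<gamma> e' t) \<le> diameter (C k)"
        using C(2) by (intro diameter_bounded_bound) (auto simp: M_def)
      also have "\<dots> \<le> \<eta> / 2" using C(2) by blast
      finally have "dist (\<gamma> e s) (\<gamma> e' t) \<le> \<eta> / 2" .
      moreover have "\<eta> \<le> dist (\<gamma> e s) (\<gamma> e' t)"
        using st \<eta> that \<open>e \<noteq> e'\<close> by (intro sep) (auto simp: M_def)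
      ultimately show False using \<eta> by simp
    qed
    have col: "(\<Sum>e\<in>B. emeasure lborel (J e k)) \<le> ennreal (diameter (C k))" for k
    proof (cases "\<exists>e\<in>B. M e k \<noteq> {}")
      case True
      then obtain e where e: "e \<in> B" "M e k \<noteq> {}" by blast
      have "(\<Sum>e\<in>B. emeasure lborel (J e k)) = (\<Sum>e\<in>{e}. emeasure lborel (J e k))"
      proof (intro sum.mono_neutral_right ballI)
        fix e' assume "e' \<in> B - {e}"
        then have "M e' k = {}" using unique e by blast
        then show "emeasure lborel (J e' k) = 0" by (simp add: J_def)
      qed (use e assms(1) in auto)
      then show ?thesis using J(2)[OF e(1)] by simp
    next
      case False
      then have "(\<Sum>e\<in>B. emeasure lborel (J e k)) = 0" by (intro sum.neutral) (auto simp: J_def)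
      then show ?thesis by simp
    qed
    have row: "ennreal (1 - 2 * \<eta>) \<le> (\<Sum>k. emeasure lborel (J e k))" if e: "e \<in> B" for e
    proof -
      have "{\<eta>..1 - \<eta>} \<subseteq> (\<Union>k. J e k)"
      proof
        fix t assume t: "t \<in> {\<eta>..1 - \<eta>}"
        then have "t \<in> {0<..<1}" using \<eta> by auto
        then have "\<gamma> e t \<in> A" using A[OF e] by blast
        then obtain k where "\<gamma> e t \<in> C k" using C(1) by blast
        then have "t \<in> M e k" using t by (simp add: M_def)
        then show "t \<in> (\<Union>k. J e k)" using J(1)[OF e] by blast
      qed
      have "ennreal (1 - 2 * \<eta>) = emeasure lborel {\<eta>..1 - \<eta>}"
        using \<eta> by simp
      also have "\<dots> \<le> emeasure lborel (\<Union>k. J e k)"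
        using \<open>{\<eta>..1 - \<eta>} \<subseteq> (\<Union>k. J e k)\<close> J_sets by (intro emeasure_mono sets.countable_UN)
      also have "\<dots> \<le> (\<Sum>k. emeasure lborel (J e k))"
        by (intro emeasure_subadditive_countably J_sets)
      finally show ?thesis .
    qed
    have "ennreal (card B * (1 - 2 * \<eta>)) = (\<Sum>e\<in>B. ennreal (1 - 2 * \<eta>))"
      using \<eta> by (simp add: ennreal_mult ennreal_of_nat_eq_real_of_nat)
    also have "\<dots> \<le> (\<Sum>e\<in>B. \<Sum>k. emeasure lborel (J e k))"
      by (intro sum_mono row)
    also have "\<dots> = (\<Sum>k. \<Sum>e\<in>B. emeasure lborel (J e k))"
      by (intro suminf_sum[symmetric]) auto
    also have "\<dots> \<le> (\<Sum>k. ennreal (diameter (C k)))"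
      by (intro suminf_le col) auto
    finally show "ennreal (card B * (1 - 2 * \<eta>)) \<le> (\<Sum>k. ennreal (diameter (C k)))" .
  qed
  show ?thesis
  proof (rule ennreal_le_epsilon)
    fix \<epsilon> :: real assume "0 < \<epsilon>"
    define \<eta> where "\<eta> = min (1 / 4) (\<epsilon> / (2 * (card B + 1)))"
    have \<eta>: "0 < \<eta>" "\<eta> < 1 / 2" using \<open>0 < \<epsilon>\<close> by (auto simp: \<eta>_def)
    have "\<eta> \<le> \<epsilon> / (2 * (card B + 1))" by (simp add: \<eta>_def)
    then have "\<eta> * (2 * (card B + 1)) \<le> \<epsilon>" by (simp add: pos_le_divide_eq)
    then have "2 * \<eta> * card B \<le> \<epsilon>" using \<eta> by (simp add: algebra_simps)
    have "of_nat (card B) = ennreal (card B * (1 - 2 * \<eta>)) + ennreal (2 * \<eta> * card B)"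
    proof -
      have "real (card B) = card B * (1 - 2 * \<eta>) + 2 * \<eta> * card B"
        by (simp add: algebra_simps)
      then show ?thesis
        using \<eta> ennreal_plus[of "card B * (1 - 2 * \<eta>)" "2 * \<eta> * card B"]
        by (simp add: ennreal_of_nat_eq_real_of_nat)
    qed
    also have "\<dots> \<le> hausdorff1_pre (\<eta> / 2) A + ennreal \<epsilon>"
      using pre[OF \<eta>] \<open>2 * \<eta> * card B \<le> \<epsilon>\<close> by (intro add_mono ennreal_leI)
    also have "\<dots> \<le> hausdorff1 A + ennreal \<epsilon>"
      unfolding hausdorff1_def using \<eta> by (intro add_mono SUP_upper) auto
    finally show "of_nat (card B) \<le> hausdorff1 A + ennreal \<epsilon>" .
  qed
qed

section \<open>Cells of the square lattice\<close>

text \<open>The four lattice points adjacent to \<open>p\<close>. Lattice points are encoded as pairs of integers.\<close>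
definition nbrs :: "int \<times> int \<Rightarrow> (int \<times> int) set" where
  "nbrs p = {(fst p + 1, snd p), (fst p - 1, snd p), (fst p, snd p + 1), (fst p, snd p - 1)}"

definition even_cell :: "int \<times> int \<Rightarrow> bool" where
  "even_cell p \<longleftrightarrow> even (fst p + snd p)"

text \<open>The lattice points on the two coordinate axes, the origin included.\<close>
definition on_axis :: "int \<times> int \<Rightarrow> bool" where
  "on_axis p \<longleftrightarrow> fst p = 0 \<or> snd p = 0"

text \<open>The even neighbour of an odd point that takes the larger share of its weight, one step closer to the origin.
Off the axes the even coordinate is decreased in absolute value, on an axis the only nonzero coordinate.\<close>
definition inner_cell :: "int \<times> int \<Rightarrow> int \<times> int" where
  "inner_cell p = (let x = fst p; y = snd p in
     if x = 0 then (0, y - sgn y) else if y = 0 then (x - sgn x, 0)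
     else if even x then (x - sgn x, y) else (x, y - sgn y))"

text \<open>The even neighbour of an odd point that takes the smaller share: the odd coordinate is increased in absolute
value. Off the axes, \<open>inner_cell p\<close> and \<open>outer_cell p\<close> are the even corners of the 2 by 2 block
containing \<open>p\<close>.\<close>
definition outer_cell :: "int \<times> int \<Rightarrow> int \<times> int" where
  "outer_cell p = (let x = fst p; y = snd p in
     if even x then (x, y + sgn y) else (x + sgn x, y))"

text \<open>The neighbour obtained by decreasing the odd coordinate in absolute value. Off the axes it is closer to the
origin than \<open>p\<close> and belongs to another block or to an axis.\<close>
definition third_cell :: "int \<times> int \<Rightarrow> int \<times> int" where
  "third_cell p = (let x = fst p; y = snd p in
     if even x then (x, y - sgn y) else (x - sgn x, y))"

text \<open>The \<open>l\<^sup>1\<close> size of a lattice point.\<close>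
definition size1 :: "int \<times> int \<Rightarrow> int" where
  "size1 p = \<bar>fst p\<bar> + \<bar>snd p\<bar>"

lemma finite_nbrs [simp]: "finite (nbrs p)"
  by (simp add: nbrs_def)

lemma card_nbrs: "card (nbrs p) = 4"
  by (simp add: nbrs_def)

lemma nbrs_sym: "q \<in> nbrs p \<longleftrightarrow> p \<in> nbrs q"
  by (cases p; cases q) (auto simp: nbrs_def)

lemma even_cell_nbrs: "q \<in> nbrs p \<Longrightarrow> even_cell q \<longleftrightarrow> \<not> even_cell p"
  by (auto simp: nbrs_def even_cell_def)

lemma
  assumes "\<not> even_cell p"
  shows inner_nbrs: "inner_cell p \<in> nbrs p" and outer_nbrs: "outer_cell p \<in> nbrs p"
    and inner_neq_outer: "inner_cell p \<noteq> outer_cell p"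
  using assms
  by (cases p; auto simp: inner_cell_def outer_cell_def nbrs_def even_cell_def Let_def sgn_if)+

lemma third_props:
  assumes "\<not> even_cell p" "\<not> on_axis p"
  shows "third_cell p \<in> nbrs p" "third_cell p \<noteq> inner_cell p" "third_cell p \<noteq> outer_cell p" "third_cell p \<noteq> (0, 0)"
  using assms
  by (cases p; auto simp: third_cell_def inner_cell_def outer_cell_def nbrs_def even_cell_def on_axis_def Let_def sgn_if)+

text \<open>The points that charge \<open>third_cell p\<close> are smaller than \<open>p\<close> or lie on an axis.\<close>
lemma charged_third:
  assumes "\<not> even_cell p" "\<not> on_axis p" "\<not> even_cell q" "inner_cell q = third_cell p \<or> outer_cell q = third_cell p"
  shows "on_axis q \<or> size1 q < size1 p"
proof -
  obtain x y a b where "p = (x, y)" "q = (a, b)" by (metis surj_pair)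
  with assms show ?thesis
    by (auto simp: third_cell_def inner_cell_def outer_cell_def even_cell_def on_axis_def size1_def Let_def sgn_if
        abs_if split: if_splits; presburger)
qed

text \<open>The odd points charging a given even point: this lemma and the three below treat inner corners of blocks, outer corners of
blocks, and the two axes.\<close>
lemma charged_odd:
  assumes "odd x" "odd y" "\<not> even_cell q"
  shows "inner_cell q = (x, y) \<Longrightarrow> q = (x + sgn x, y) \<or> q = (x, y + sgn y)" and "outer_cell q \<noteq> (x, y)"
  using assms
  by (cases q; auto simp: inner_cell_def outer_cell_def even_cell_def Let_def sgn_if split: if_splits; presburger)+

lemma charged_even:
  assumes "even x" "even y" "x \<noteq> 0" "y \<noteq> 0" "\<not> even_cell q"
  shows "outer_cell q = (x, y) \<Longrightarrow> q = (x - sgn x, y) \<or> q = (x, y - sgn y)" and "inner_cell q \<noteq> (x, y)"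
  using assms
  by (cases q; auto simp: inner_cell_def outer_cell_def even_cell_def Let_def sgn_if split: if_splits; presburger)+

lemma charged_axis1:
  assumes "even x" "x \<noteq> 0" "\<not> even_cell q"
  shows "inner_cell q = (x, 0) \<Longrightarrow> q = (x + sgn x, 0)" and "outer_cell q = (x, 0) \<Longrightarrow> q = (x - sgn x, 0)"
  using assms
  by (cases q; auto simp: inner_cell_def outer_cell_def even_cell_def Let_def sgn_if split: if_splits; presburger)+

lemma charged_axis2:
  assumes "even y" "y \<noteq> 0" "\<not> even_cell q"
  shows "inner_cell q = (0, y) \<Longrightarrow> q = (0, y + sgn y)" and "outer_cell q = (0, y) \<Longrightarrow> q = (0, y - sgn y)"
  using assms
  by (cases q; auto simp: inner_cell_def outer_cell_def even_cell_def Let_def sgn_if split: if_splits; presburger)+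

text \<open>The next point away from the origin on the same coordinate axis.\<close>
definition axis_succ :: "int \<times> int \<Rightarrow> int \<times> int" where
  "axis_succ p = (fst p + sgn (fst p), snd p + sgn (snd p))"

text \<open>The next point towards the origin on the same coordinate axis.\<close>
definition axis_pred :: "int \<times> int \<Rightarrow> int \<times> int" where
  "axis_pred p = (fst p - sgn (fst p), snd p - sgn (snd p))"

lemma axis_cells:
  assumes "on_axis j" "even_cell j" "j \<noteq> (0, 0)"
  shows "inner_cell (axis_succ j) = j" "outer_cell (axis_succ j) = axis_succ (axis_succ j)"
    "outer_cell (axis_pred j) = j \<or> axis_pred j = (0, 0)"
  using assms
  by (cases j; auto simp: inner_cell_def outer_cell_def axis_succ_def axis_pred_def on_axis_def
      even_cell_def Let_def sgn_if split: if_splits)+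

lemma axis_odd:
  assumes "on_axis p" "\<not> even_cell p"
  shows "outer_cell p = axis_succ p" "inner_cell p = axis_pred p" "on_axis (axis_succ p)"
    "even_cell (axis_succ p)" "axis_succ p \<noteq> (0, 0)" "axis_pred (axis_succ p) = p"
    "even_cell (axis_pred p)" "axis_pred p \<noteq> (0, 0) \<Longrightarrow> axis_succ (axis_pred p) = p"
    "on_axis (axis_pred p)" 
  using assms
  by (cases p; auto simp: outer_cell_def inner_cell_def axis_succ_def axis_pred_def on_axis_def
      even_cell_def Let_def sgn_if split: if_splits)+

lemma sum_le_two:
  assumes "finite S" "\<And>i. i \<in> S \<Longrightarrow> i \<noteq> a \<Longrightarrow> i \<noteq> b \<Longrightarrow> f i = 0" "\<And>i. 0 \<le> f i"
  shows "(\<Sum>i\<in>S. f i) \<le> f a + (f b :: real)"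
proof -
  have "(\<Sum>i\<in>S. f i) = (\<Sum>i\<in>S \<inter> {a, b}. f i)"
    using assms by (intro sum.mono_neutral_right) auto
  also have "\<dots> \<le> (\<Sum>i\<in>{a, b}. f i)"
    using assms by (intro sum_mono2) auto
  also have "\<dots> \<le> f a + f b"
    using assms(3) by (cases "a = b") auto
  finally show ?thesis .
qed

text \<open>Adjacency is bipartite, so each adjacent pair in \<open>I\<close> is seen once from its odd point.\<close>
lemma sum_card_nbrs:
  fixes I :: "(int \<times> int) set"
  assumes "finite I" "E = {p \<in> I. even_cell p}" "U = {p \<in> I. \<not> even_cell p}"
  shows "(\<Sum>p\<in>I. real (card (nbrs p \<inter> I))) = 2 * (\<Sum>p\<in>U. real (card (nbrs p \<inter> E)))"
proof -
  have fin: "finite E" "finite U" and I: "I = E \<union> U" "E \<inter> U = {}"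
    using assms by auto
  have card_eq: "real (card (nbrs p \<inter> S)) = (\<Sum>q\<in>S. of_bool (q \<in> nbrs p))"
    if "finite S" for p and S :: "(int \<times> int) set"
    using that by (simp add: Int_commute)
  have "(\<Sum>p\<in>E. real (card (nbrs p \<inter> U))) = (\<Sum>p\<in>E. \<Sum>q\<in>U. of_bool (q \<in> nbrs p))"
    using card_eq fin by simp
  also have "\<dots> = (\<Sum>q\<in>U. \<Sum>p\<in>E. of_bool (q \<in> nbrs p))"
    by (rule sum.swap)
  also have "\<dots> = (\<Sum>q\<in>U. \<Sum>p\<in>E. of_bool (p \<in> nbrs q))"
    using nbrs_sym by simp
  also have "\<dots> = (\<Sum>q\<in>U. real (card (nbrs q \<inter> E)))"
    using card_eq fin by simp
  finally have swap: "(\<Sum>p\<in>E. real (card (nbrs p \<inter> U))) = (\<Sum>q\<in>U. real (card (nbrs q \<inter> E)))" .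
  have E: "nbrs p \<inter> I = nbrs p \<inter> U" if "p \<in> E" for p
    using that assms by (auto dest: even_cell_nbrs)
  have U: "nbrs p \<inter> I = nbrs p \<inter> E" if "p \<in> U" for p
    using that assms by (auto dest: even_cell_nbrs)
  have "(\<Sum>p\<in>I. real (card (nbrs p \<inter> I))) =
      (\<Sum>p\<in>E. real (card (nbrs p \<inter> I))) + (\<Sum>p\<in>U. real (card (nbrs p \<inter> I)))"
    unfolding I(1) using fin I(2) by (intro sum.union_disjoint)
  then show ?thesis using E U swap by simp
qed

lemma card_nbrs_ge:
  assumes "S \<subseteq> nbrs p" "S \<subseteq> N"
  shows "card S \<le> card (nbrs p \<inter> N)"
  using assms by (intro card_mono) auto

section \<open>The weighted edge-counting problem on the lattice\<close>

text \<open>The properties of \<open>w(p) = 4 - \<alpha> \<phi>(p)\<close> that enter the combinatorial argument: invariance under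
reflections and monotonicity, linearity along the axes, supermodularity on the quadrant, and the bound
\<open>\<phi>(p + e\<^sub>i) \<le> 2 \<phi>(p)\<close> when the \<open>i\<close>-th coordinate of \<open>p\<close> is
positive. The hypothesis \<open>w_noncritical\<close> says that \<open>\<alpha>\<close> is not critical, and \<open>finite_pos\<close> that the norm balls are bounded.\<close>
locale checkerboard_weight =
  fixes w :: "int \<times> int \<Rightarrow> real"
  assumes w_abs: "w (x, y) = w (\<bar>x\<bar>, \<bar>y\<bar>)"
    and w_origin: "w (0, 0) = 4"
    and w_less_4: "p \<noteq> (0, 0) \<Longrightarrow> w p < 4"
    and w_antimono: "\<lbrakk>0 \<le> x; x \<le> x'; 0 \<le> y; y \<le> y'\<rbrakk> \<Longrightarrow> w (x', y') \<le> w (x, y)"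
    and w_axis1: "0 < x \<Longrightarrow> 2 * w (x, 0) = w (x - 1, 0) + w (x + 1, 0)"
    and w_axis2: "0 < y \<Longrightarrow> 2 * w (0, y) = w (0, y - 1) + w (0, y + 1)"
    and w_block: "\<lbrakk>0 \<le> x; 0 \<le> y\<rbrakk> \<Longrightarrow> w (x + 1, y) + w (x, y + 1) \<le> w (x, y) + w (x + 1, y + 1)"
    and w_step1: "\<lbrakk>0 < x; 0 \<le> y\<rbrakk> \<Longrightarrow> 2 * w (x, y) - 4 \<le> w (x + 1, y)"
    and w_step2: "\<lbrakk>0 \<le> x; 0 < y\<rbrakk> \<Longrightarrow> 2 * w (x, y) - 4 \<le> w (x, y + 1)"
    and w_noncritical: "\<lbrakk>even_cell p; p \<noteq> (0, 0)\<rbrakk> \<Longrightarrow> w p \<noteq> 0"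
    and finite_pos: "finite {p. 0 < w p}"
begin

text \<open>The positive part of the weight.\<close>
definition pos :: "int \<times> int \<Rightarrow> real" where
  "pos p = max 0 (w p)"

text \<open>The share of the odd point \<open>p\<close> sent to \<open>outer_cell p\<close>: half the capacity of that cell. Off the axes
the other half is left to the second odd point of the same block.\<close>
definition outer_charge :: "int \<times> int \<Rightarrow> real" where
  "outer_charge p = pos (outer_cell p) / 2"

text \<open>The remaining share of the odd point \<open>p\<close>, sent to \<open>inner_cell p\<close>.\<close>
definition inner_charge :: "int \<times> int \<Rightarrow> real" where
  "inner_charge p = pos p - outer_charge p"

text \<open>The share that the even point \<open>q\<close> receives from the odd point \<open>p\<close>.\<close>
definition charge :: "int \<times> int \<Rightarrow> int \<times> int \<Rightarrow> real" where
  "charge p q = (if q = inner_cell p then inner_charge p else 0) +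
                (if q = outer_cell p then outer_charge p else 0)"

text \<open>The objective, equal to minus the energy of the set of squares centred at \<open>I\<close>. The count of neighbours
runs over ordered pairs, so each adjacent pair contributes 2.\<close>
definition gain :: "(int \<times> int) set \<Rightarrow> real" where
  "gain I = (\<Sum>p\<in>I. w p - card (nbrs p \<inter> I))"

text \<open>The even points of positive weight: the optimal set.\<close>
definition pos_even :: "(int \<times> int) set" where
  "pos_even = {p. even_cell p \<and> 0 < w p}"

lemma finite_pos_even: "finite pos_even"
  unfolding pos_even_def by (rule finite_subset[OF _ finite_pos]) auto

lemma w_le_4: "w p \<le> 4"
  using w_less_4[of p] w_origin by (cases "p = (0, 0)") auto

lemma pos_nonneg [simp]: "0 \<le> pos p" and w_le_pos: "w p \<le> pos p" and pos_le_4: "pos p \<le> 4"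
  using w_le_4[of p] by (auto simp: pos_def)

lemma pos_antimono: "\<lbrakk>\<bar>x\<bar> \<le> \<bar>x'\<bar>; \<bar>y\<bar> \<le> \<bar>y'\<bar>\<rbrakk> \<Longrightarrow> pos (x', y') \<le> pos (x, y)"
  using w_antimono[of "\<bar>x\<bar>" "\<bar>x'\<bar>" "\<bar>y\<bar>" "\<bar>y'\<bar>"] w_abs[of x y] w_abs[of x' y']
  unfolding pos_def by (intro max.mono) auto

lemma outer_charge_nonneg [simp]: "0 \<le> outer_charge p"
  by (simp add: outer_charge_def)

lemma outer_charge_le: "outer_charge p \<le> pos p / 2"
proof -
  obtain x y where p: "p = (x, y)" by fastforce
  show ?thesis unfolding outer_charge_def p outer_cell_def Let_def
    by (auto intro!: divide_right_mono pos_antimono simp: sgn_if)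
qed

lemma inner_charge_nonneg [simp]: "0 \<le> inner_charge p"
  using outer_charge_le[of p] pos_nonneg[of p] unfolding inner_charge_def by linarith

lemma charge_nonneg [simp]: "0 \<le> charge p q"
  by (simp add: charge_def)

lemma w_step_outer:
  assumes "\<not> even_cell p"
  shows "2 * w p - 4 \<le> w (outer_cell p)"
proof -
  obtain x y where p: "p = (x, y)" by fastforce
  show ?thesis
  proof (cases "even x")
    case True
    then have y: "y \<noteq> 0" "odd y" using assms by (auto simp: p even_cell_def)
    have "w (x, y + sgn y) = w (\<bar>x\<bar>, \<bar>y\<bar> + 1)"
      using y by (subst w_abs) (auto simp: sgn_if)
    with w_step2[of "\<bar>x\<bar>" "\<bar>y\<bar>"] w_abs[of x y] y True show ?thesis
      by (simp add: p outer_cell_def)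
  next
    case False
    then have x: "x \<noteq> 0" by auto
    have "w (x + sgn x, y) = w (\<bar>x\<bar> + 1, \<bar>y\<bar>)"
      using x by (subst w_abs) (auto simp: sgn_if)
    with w_step1[of "\<bar>x\<bar>" "\<bar>y\<bar>"] w_abs[of x y] x False show ?thesis
      by (simp add: p outer_cell_def)
  qed
qed

text \<open>This is \<open>2 w(p) - 4 \<le> w(outer_cell p)\<close>, the doubling bound, with positive parts taken.\<close>
lemma inner_charge_le_2:
  assumes "\<not> even_cell p"
  shows "inner_charge p \<le> 2"
  using w_step_outer[OF assms] unfolding inner_charge_def outer_charge_def pos_def by auto

lemma outer_charge_le_2: "outer_charge p \<le> 2"
  using pos_le_4[of "outer_cell p"] by (simp add: outer_charge_def)

text \<open>Supermodularity survives taking positive parts because the weight is decreasing in the quadrant.\<close>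
lemma pos_block:
  assumes "0 \<le> x" "0 \<le> y"
  shows "pos (x + 1, y) + pos (x, y + 1) \<le> pos (x, y) + pos (x + 1, y + 1)"
  using w_block[OF assms] w_antimono[of x "x + 1" y y] w_antimono[of x x y "y + 1"] assms
  by (auto simp: pos_def max_def)

lemma pos_abs: "pos (x, y) = pos (\<bar>x\<bar>, \<bar>y\<bar>)"
  unfolding pos_def using w_abs[of x y] by simp

lemma pos_axis1: "0 < x \<Longrightarrow> 2 * pos (x, 0) \<le> pos (x - 1, 0) + pos (x + 1, 0)"
  using w_axis1[of x] by (auto simp: pos_def)

lemma pos_axis2: "0 < y \<Longrightarrow> 2 * pos (0, y) \<le> pos (0, y - 1) + pos (0, y + 1)"
  using w_axis2[of y] by (auto simp: pos_def)

lemma charge_eq_0: "inner_cell p \<noteq> q \<Longrightarrow> outer_cell p \<noteq> q \<Longrightarrow> charge p q = 0"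
  by (auto simp: charge_def)

lemma charge_inner: "\<not> even_cell p \<Longrightarrow> inner_cell p = q \<Longrightarrow> charge p q = inner_charge p"
  and charge_outer: "\<not> even_cell p \<Longrightarrow> outer_cell p = q \<Longrightarrow> charge p q = outer_charge p"
  using inner_neq_outer[of p] by (auto simp: charge_def)

lemma charge_axis_eq_0:
  assumes "on_axis j" "even_cell j" "j \<noteq> (0, 0)" "\<not> even_cell q"
    "q \<noteq> axis_succ j" "q \<noteq> axis_pred j"
  shows "charge q j = 0"
proof -
  obtain x y where j: "j = (x, y)" by fastforce
  show ?thesis
  proof (cases "y = 0")
    case True
    then show ?thesis using assms charged_axis1[of x q]
      by (intro charge_eq_0) (auto simp: j even_cell_def axis_succ_def axis_pred_def)
  next
    case False
    then have "x = 0" using assms(1) by (simp add: j on_axis_def)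
    then show ?thesis using assms charged_axis2[of y q]
      by (intro charge_eq_0) (auto simp: j even_cell_def axis_succ_def axis_pred_def)
  qed
qed

lemma pos_axis:
  assumes "on_axis j" "even_cell j" "j \<noteq> (0, 0)"
  shows "2 * pos (axis_succ j) \<le> pos j + pos (axis_succ (axis_succ j))"
proof -
  obtain x y where j: "j = (x, y)" by fastforce
  have abs_sgn: "\<bar>z + sgn z\<bar> = \<bar>z\<bar> + 1" "\<bar>z + sgn z + sgn (z + sgn z)\<bar> = \<bar>z\<bar> + 2"
    if "z \<noteq> 0" for z :: int
    using that by (auto simp: sgn_if)
  show ?thesis
  proof (cases "y = 0")
    case True
    then have x: "x \<noteq> 0" using assms by (simp add: j)
    have "pos (axis_succ j) = pos (\<bar>x\<bar> + 1, 0)" "pos (axis_succ (axis_succ j)) = pos (\<bar>x\<bar> + 2, 0)"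
      "pos j = pos (\<bar>x\<bar>, 0)"
      using x unfolding j axis_succ_def True by (subst pos_abs, simp add: abs_sgn)+
    with pos_axis1[of "\<bar>x\<bar> + 1"] show ?thesis by (simp add: add.commute)
  next
    case False
    then have x: "x = 0" using assms(1) by (simp add: j on_axis_def)
    have "pos (axis_succ j) = pos (0, \<bar>y\<bar> + 1)" "pos (axis_succ (axis_succ j)) = pos (0, \<bar>y\<bar> + 2)"
      "pos j = pos (0, \<bar>y\<bar>)"
      using False unfolding j axis_succ_def x by (subst pos_abs, simp add: abs_sgn)+
    with pos_axis2[of "\<bar>y\<bar> + 1"] show ?thesis by (simp add: add.commute)
  qed
qed

lemma charge_axis:
  assumes "on_axis j" "even_cell j" "j \<noteq> (0, 0)"
  shows "charge (axis_succ j) j = pos (axis_succ j) - pos (axis_succ (axis_succ j)) / 2"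
    "charge (axis_pred j) j = pos j / 2"
proof -
  have "axis_succ (axis_succ j) \<noteq> j"
    using assms(3) by (cases j) (auto simp: axis_succ_def sgn_if split: if_splits)
  then show "charge (axis_succ j) j = pos (axis_succ j) - pos (axis_succ (axis_succ j)) / 2"
    using axis_cells[OF assms] by (simp add: charge_def inner_charge_def outer_charge_def)
  have "axis_pred j \<noteq> (0, 0) \<and> inner_cell (axis_pred j) \<noteq> j"
    using assms by (cases j) (auto simp: axis_pred_def inner_cell_def even_cell_def on_axis_def Let_def
        sgn_if split: if_splits)
  then show "charge (axis_pred j) j = pos j / 2"
    using axis_cells[OF assms] by (auto simp: charge_def inner_charge_def outer_charge_def)
qed

text \<open>No even point other than the origin receives more than its capacity. There are three cases: points on an axis,
inner corners of blocks (both coordinates odd), outer corners of blocks (both coordinates even).\<close>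
lemma load_le:
  assumes "finite S" "\<And>p. p \<in> S \<Longrightarrow> \<not> even_cell p" "even_cell j" "j \<noteq> (0, 0)"
  shows "(\<Sum>p\<in>S. charge p j) \<le> pos j"
proof -
  obtain x y where j: "j = (x, y)" by fastforce
  consider "on_axis j" | "odd x" "odd y" | "x \<noteq> 0" "y \<noteq> 0" "even x" "even y"
    using assms(3) by (auto simp: j even_cell_def on_axis_def)
  then show ?thesis
  proof cases
    case 1
    have "(\<Sum>p\<in>S. charge p j) \<le> charge (axis_succ j) j + charge (axis_pred j) j"
      using assms 1 charge_axis_eq_0 by (intro sum_le_two) auto
    also have "\<dots> \<le> pos j"
      using charge_axis[of j] pos_axis[of j] 1 assms by simp
    finally show ?thesis .
  next
    case 2
    let ?b = "(x + sgn x, y)" and ?c = "(x, y + sgn y)" and ?d = "(x + sgn x, y + sgn y)"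
    have xy: "x \<noteq> 0" "y \<noteq> 0" using 2 by auto
    have "(\<Sum>p\<in>S. charge p j) \<le> charge ?b j + charge ?c j"
      using assms(1,2) charged_odd[OF 2] unfolding j
      by (intro sum_le_two[OF _ charge_eq_0] charge_nonneg) blast+
    also have "charge ?b j = pos ?b - pos ?d / 2"
    proof -
      have "\<not> even_cell ?b" "inner_cell ?b = j" "outer_cell ?b = ?d"
        using 2 xy by (auto simp: j inner_cell_def outer_cell_def even_cell_def sgn_if)
      then show ?thesis by (simp add: charge_inner inner_charge_def outer_charge_def)
    qed
    also have "charge ?c j = pos ?c - pos ?d / 2"
    proof -
      have "\<not> even_cell ?c" "inner_cell ?c = j" "outer_cell ?c = ?d"
        using 2 xy by (auto simp: j inner_cell_def outer_cell_def even_cell_def sgn_if)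
      then show ?thesis by (simp add: charge_inner inner_charge_def outer_charge_def)
    qed
    also have "pos ?b - pos ?d / 2 + (pos ?c - pos ?d / 2) \<le> pos (x, y)"
    proof -
      have "\<bar>x + sgn x\<bar> = \<bar>x\<bar> + 1" "\<bar>y + sgn y\<bar> = \<bar>y\<bar> + 1"
        using xy by (auto simp: sgn_if)
      then show ?thesis
        using pos_block[of "\<bar>x\<bar>" "\<bar>y\<bar>"] pos_abs[of "x + sgn x" y] pos_abs[of x "y + sgn y"]
          pos_abs[of "x + sgn x" "y + sgn y"] pos_abs[of x y]
        by simp
    qed
    finally show ?thesis by (simp add: j)
  next
    case 3
    let ?b = "(x - sgn x, y)" and ?c = "(x, y - sgn y)"
    have "(\<Sum>p\<in>S. charge p j) \<le> charge ?b j + charge ?c j"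
      using assms(1,2) charged_even[OF 3(3,4,1,2)] unfolding j
      by (intro sum_le_two[OF _ charge_eq_0] charge_nonneg) blast+
    also have "charge ?b j = pos j / 2"
    proof -
      have "\<not> even_cell ?b" "outer_cell ?b = j"
        using 3 by (auto simp: j outer_cell_def even_cell_def sgn_if)
      then show ?thesis by (simp add: charge_outer outer_charge_def)
    qed
    also have "charge ?c j = pos j / 2"
    proof -
      have "\<not> even_cell ?c" "outer_cell ?c = j"
        using 3 by (auto simp: j outer_cell_def even_cell_def sgn_if)
      then show ?thesis by (simp add: charge_outer outer_charge_def)
    qed
    finally show ?thesis by simp
  qed
qed

lemma sum_charge:
  assumes "\<not> even_cell p" "finite S"
  shows "(\<Sum>q\<in>S. charge p q) = (if inner_cell p \<in> S then inner_charge p else 0) +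
    (if outer_cell p \<in> S then outer_charge p else 0)"
  using assms by (simp add: charge_def sum.distrib sum.delta')

text \<open>An odd point costs at least as much as it contributes: the shares sent into \<open>N\<close> are covered by the
adjacency cost, the others are available as unused capacity.\<close>
lemma odd_deficit_nonneg:
  assumes p: "\<not> even_cell p" and "finite N" "finite M" and M: "inner_cell p \<in> M" "outer_cell p \<in> M"
  shows "w p \<le> 2 * real (card (nbrs p \<inter> N)) + (\<Sum>q\<in>M - N. charge p q)"
proof -
  have "card ({inner_cell p, outer_cell p} \<inter> N) \<le> card (nbrs p \<inter> N)"
    using inner_nbrs[OF p] outer_nbrs[OF p] by (intro card_nbrs_ge) auto
  then have "of_bool (inner_cell p \<in> N) + of_bool (outer_cell p \<in> N) \<le> real (card (nbrs p \<inter> N))"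
    using inner_neq_outer[OF p] by (auto simp: Int_insert_left split: if_splits)
  moreover have "inner_charge p + outer_charge p = pos p"
    by (simp add: inner_charge_def)
  ultimately show ?thesis
    using sum_charge[OF p, of "M - N"] assms inner_charge_le_2[OF p] outer_charge_le_2[of p] w_le_pos[of p]
    by (auto split: if_splits)
qed

text \<open>The difference between the optimal value and the gain of \<open>I\<close>, split into the even points of \<open>I\<close>,
its odd points, and the even points left out of \<open>I\<close>; \<open>M\<close> is any sufficiently large finite set of
even points.\<close>
lemma gain_deficit:
  assumes "finite I" and E: "E = {p \<in> I. even_cell p}" and U: "U = {p \<in> I. \<not> even_cell p}"
    and M: "finite M" "E \<subseteq> M" "pos_even \<subseteq> M" "\<And>p. p \<in> M \<Longrightarrow> even_cell p"
  shows "(\<Sum>p\<in>pos_even. w p) - gain I = (\<Sum>p\<in>E. pos p - w p) +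
    (\<Sum>p\<in>U. 2 * real (card (nbrs p \<inter> E)) + (\<Sum>q\<in>M - E. charge p q) - w p) +
    (\<Sum>q\<in>M - E. pos q - (\<Sum>p\<in>U. charge p q))"
proof -
  have fin: "finite E" "finite U" and I: "I = E \<union> U" "E \<inter> U = {}"
    using assms by auto
  have "(\<Sum>p\<in>pos_even. w p) = (\<Sum>p\<in>pos_even. pos p)"
    by (intro sum.cong) (auto simp: pos_even_def pos_def)
  also have "\<dots> = (\<Sum>p\<in>M. pos p)"
    using M by (intro sum.mono_neutral_left) (auto simp: pos_even_def pos_def)
  also have "\<dots> = (\<Sum>p\<in>E. pos p) + (\<Sum>p\<in>M - E. pos p)"
    using M by (metis add.commute sum.subset_diff)
  finally have val: "(\<Sum>p\<in>pos_even. w p) = (\<Sum>p\<in>E. pos p) + (\<Sum>p\<in>M - E. pos p)" .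
  have "gain I = (\<Sum>p\<in>I. w p) - (\<Sum>p\<in>I. real (card (nbrs p \<inter> I)))"
    by (simp add: gain_def sum_subtractf)
  also have "(\<Sum>p\<in>I. w p) = (\<Sum>p\<in>E. w p) + (\<Sum>p\<in>U. w p)"
    unfolding I(1) using fin I(2) by (intro sum.union_disjoint)
  also note sum_card_nbrs[OF assms(1-3)]
  finally have gain: "gain I = (\<Sum>p\<in>E. w p) + (\<Sum>p\<in>U. w p) - 2 * (\<Sum>p\<in>U. real (card (nbrs p \<inter> E)))" .
  have "(\<Sum>p\<in>U. \<Sum>q\<in>M - E. charge p q) = (\<Sum>q\<in>M - E. \<Sum>p\<in>U. charge p q)"
    by (rule sum.swap)
  then show ?thesis
    unfolding val gain by (simp add: sum.distrib sum_subtractf sum_distrib_left)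
qed

lemma w_le_third_cell:
  assumes "\<not> even_cell p" "\<not> on_axis p"
  shows "w p \<le> w (third_cell p)"
proof -
  obtain x y where p: "p = (x, y)" by fastforce
  have mono: "w (x, y) \<le> w (x', y')" if "\<bar>x'\<bar> \<le> \<bar>x\<bar>" "\<bar>y'\<bar> \<le> \<bar>y\<bar>" for x' y'
    using w_antimono[of "\<bar>x'\<bar>" "\<bar>x\<bar>" "\<bar>y'\<bar>" "\<bar>y\<bar>"] w_abs[of x y] w_abs[of x' y'] that by simp
  show ?thesis
    unfolding p third_cell_def Let_def using mono by (auto simp: sgn_if)
qed

lemma w_axis_mid:
  assumes "on_axis p" "\<not> even_cell p"
  shows "2 * w p = w (axis_pred p) + w (axis_succ p)"
proof -
  obtain x y where p: "p = (x, y)" by fastforce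
  have abs_sgn: "\<bar>z + sgn z\<bar> = \<bar>z\<bar> + 1" "\<bar>z - sgn z\<bar> = \<bar>z\<bar> - 1"
    if "z \<noteq> 0" for z :: int
    using that by (auto simp: sgn_if)
  show ?thesis
  proof (cases "y = 0")
    case True
    then have x: "x \<noteq> 0" using assms by (auto simp: p even_cell_def)
    have "w (axis_succ p) = w (\<bar>x\<bar> + 1, 0)" "w (axis_pred p) = w (\<bar>x\<bar> - 1, 0)" "w p = w (\<bar>x\<bar>, 0)"
      using x unfolding p axis_succ_def axis_pred_def True by (subst w_abs, simp add: abs_sgn)+
    with w_axis1[of "\<bar>x\<bar>"] x show ?thesis by simp
  next
    case False
    then have x: "x = 0" using assms(1) by (simp add: p on_axis_def)
    have "w (axis_succ p) = w (0, \<bar>y\<bar> + 1)" "w (axis_pred p) = w (0, \<bar>y\<bar> - 1)" "w p = w (0, \<bar>y\<bar>)"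
      using False unfolding p axis_succ_def axis_pred_def x by (subst w_abs, simp add: abs_sgn)+
    with w_axis2[of "\<bar>y\<bar>"] False show ?thesis by simp
  qed
qed

lemma gain_le:
  assumes "finite I" "(0, 0) \<in> I"
  shows "gain I \<le> (\<Sum>p\<in>pos_even. w p)" "gain I = (\<Sum>p\<in>pos_even. w p) \<Longrightarrow> I = pos_even"
proof -
  define E where "E = {p \<in> I. even_cell p}"
  define U where "U = {p \<in> I. \<not> even_cell p}"
  define M where "M = E \<union> pos_even \<union> inner_cell ` U \<union> outer_cell ` U"
  have fin: "finite E" "finite U" "finite M"
    using assms(1) finite_pos_even by (auto simp: E_def U_def M_def)
  have U_odd: "\<not> even_cell p" if "p \<in> U" for p using that by (simp add: U_def)
  have M_even: "even_cell q" if "q \<in> M" for q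
    using that even_cell_nbrs[OF inner_nbrs] even_cell_nbrs[OF outer_nbrs]
    by (auto simp: M_def E_def U_def pos_even_def)
  have M_inner: "inner_cell p \<in> M" "outer_cell p \<in> M" if "p \<in> U" for p
    using that by (auto simp: M_def)
  have origin: "(0, 0) \<in> E"
    using assms(2) by (simp add: E_def even_cell_def)
  let ?D1 = "\<lambda>p. pos p - w p"
  let ?D2 = "\<lambda>p. 2 * real (card (nbrs p \<inter> E)) + (\<Sum>q\<in>M - E. charge p q) - w p"
  let ?D3 = "\<lambda>q. pos q - (\<Sum>p\<in>U. charge p q)"
  have D1: "0 \<le> ?D1 p" if "p \<in> E" for p using w_le_pos by simp
  have D2: "0 \<le> ?D2 p" if "p \<in> U" for p
    using odd_deficit_nonneg[OF U_odd fin(1,3) M_inner] that by simp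
  have D3: "0 \<le> ?D3 q" if "q \<in> M - E" for q
  proof -
    have "q \<noteq> (0, 0)" using origin that by auto
    then show ?thesis
      using load_le[OF fin(2) U_odd] M_even that by simp
  qed
  have total: "(\<Sum>p\<in>pos_even. w p) - gain I = sum ?D1 E + sum ?D2 U + sum ?D3 (M - E)"
    using fin M_even by (intro gain_deficit[OF assms(1) E_def U_def]) (auto simp: M_def)
  have nonneg: "0 \<le> sum ?D1 E" "0 \<le> sum ?D2 U" "0 \<le> sum ?D3 (M - E)"
    using sum_nonneg[OF D1] sum_nonneg[OF D2] sum_nonneg[OF D3] by - assumption+
  show "gain I \<le> (\<Sum>p\<in>pos_even. w p)" using total nonneg by linarith
  assume eq: "gain I = (\<Sum>p\<in>pos_even. w p)"
  have zero: "sum ?D1 E = 0" "sum ?D2 U = 0" "sum ?D3 (M - E) = 0"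
    using total nonneg eq by linarith+
  have D1: "?D1 p = 0" if "p \<in> E" for p
    by (rule bspec[OF iffD1[OF sum_nonneg_eq_0_iff[OF fin(1) D1] zero(1)] that])
  have D2: "?D2 p = 0" if "p \<in> U" for p
    by (rule bspec[OF iffD1[OF sum_nonneg_eq_0_iff[OF fin(2) D2] zero(2)] that])
  have D3: "?D3 q = 0" if "q \<in> M - E" for q
    by (rule bspec[OF iffD1[OF sum_nonneg_eq_0_iff[OF finite_Diff[OF fin(3)] D3] zero(3)] that])
  have charges: "(\<Sum>q\<in>M - E. charge p q) = (if inner_cell p \<in> E then 0 else inner_charge p) +
      (if outer_cell p \<in> E then 0 else outer_charge p)" if "p \<in> U" for p
    using sum_charge[OF U_odd[OF that], of "M - E"] M_inner[OF that] fin by simp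
  have nbrs_ge: "of_bool (inner_cell p \<in> E) + of_bool (outer_cell p \<in> E) \<le> real (card (nbrs p \<inter> E))"
    if "p \<in> U" for p
  proof -
    have "card ({inner_cell p, outer_cell p} \<inter> E) \<le> card (nbrs p \<inter> E)"
      using inner_nbrs[OF U_odd[OF that]] outer_nbrs[OF U_odd[OF that]] by (intro card_nbrs_ge) auto
    then show ?thesis
      using inner_neq_outer[OF U_odd[OF that]] by (auto simp: Int_insert_left split: if_splits)
  qed
  have split: "inner_charge p + outer_charge p = pos p" for p
    by (simp add: inner_charge_def)
  \<comment> \<open>Consequences of the vanishing of the deficit of a single odd point.\<close>
  have w_eq_pos: "w p = pos p" if "p \<in> U" for p
    using D2[OF that] charges[OF that] nbrs_ge[OF that] split[of p] w_le_pos[of p]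
      inner_charge_le_2[OF U_odd[OF that]] outer_charge_le_2[of p]
    by (auto split: if_splits)
  have inner_tight: "inner_charge p = 2" if "p \<in> U" "inner_cell p \<in> E" for p
    using D2[OF that(1)] charges[OF that(1)] nbrs_ge[OF that(1)] split[of p] w_le_pos[of p] that(2)
      inner_charge_le_2[OF U_odd[OF that(1)]] outer_charge_le_2[of p]
    by (auto split: if_splits)
  have outer_free: "outer_cell p \<notin> E" if "p \<in> U" for p
  proof
    assume E: "outer_cell p \<in> E"
    have "outer_cell p \<noteq> (0, 0)"
      using U_odd[OF that] by (cases p) (auto simp: outer_cell_def even_cell_def Let_def sgn_if split: if_splits)
    then have "outer_charge p < 2"
      using w_less_4 by (auto simp: outer_charge_def pos_def)
    then show False
      using D2[OF that] charges[OF that] nbrs_ge[OF that] split[of p] w_le_pos[of p] E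
        inner_charge_le_2[OF U_odd[OF that]]
      by (auto split: if_splits)
  qed
  have third_free: "third_cell p \<notin> E" if "p \<in> U" "\<not> on_axis p" for p
  proof
    assume E: "third_cell p \<in> E"
    note third = third_props[OF U_odd[OF that(1)] that(2)]
    have "card ({inner_cell p, third_cell p} \<inter> E) \<le> card (nbrs p \<inter> E)"
      using inner_nbrs[OF U_odd[OF that(1)]] third(1) by (intro card_nbrs_ge) auto
    then have "1 + of_bool (inner_cell p \<in> E) \<le> real (card (nbrs p \<inter> E))"
      using E third by (auto simp: Int_insert_left split: if_splits)
    then show False
      using D2[OF that(1)] charges[OF that(1)] split[of p] w_le_pos[of p] outer_free[OF that(1)]
        inner_charge_le_2[OF U_odd[OF that(1)]]
      by (auto split: if_splits)
  qed
  \<comment> \<open>An odd axis point \<open>m\<close> of maximal size leaves half of the capacity of its outer neighbour unused.\<close>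
  have no_axis: "\<not> on_axis p" if p: "p \<in> U" for p
  proof
    assume "on_axis p"
    define A where "A = {p \<in> U. on_axis p}"
    have "finite A" "p \<in> A"
      using fin p \<open>on_axis p\<close> by (simp_all add: A_def)
    then have "finite A" "A \<noteq> {}" by auto
    then obtain m where m: "m \<in> A" and max: "\<And>q. q \<in> A \<Longrightarrow> size1 q \<le> size1 m"
      using arg_min_if_finite[of A "\<lambda>q. - size1 q"] by fastforce
    then have mU: "m \<in> U" and m_axis: "on_axis m" and m_odd: "\<not> even_cell m"
      using U_odd by (auto simp: A_def)
    note ax = axis_odd[OF m_axis m_odd]
    let ?d = "axis_succ m" and ?a = "axis_pred m"
    have "axis_succ ?d \<notin> U"
    proof
      assume "axis_succ ?d \<in> U"
      moreover have "on_axis (axis_succ ?d)" "size1 m < size1 (axis_succ ?d)"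
        using m_axis m_odd by (cases m; auto simp: on_axis_def axis_succ_def even_cell_def size1_def sgn_if)+
      ultimately show False using max[of "axis_succ ?d"] by (auto simp: A_def)
    qed
    then have "charge q ?d = 0" if "q \<in> U - {m}" for q
      using that by (intro charge_axis_eq_0 ax(3-5) U_odd) (auto simp: ax(6))
    then have "(\<Sum>p\<in>U. charge p ?d) = (\<Sum>p\<in>{m}. charge p ?d)"
      using fin mU by (intro sum.mono_neutral_right) auto
    then have "(\<Sum>p\<in>U. charge p ?d) = pos ?d / 2"
      using charge_axis(2)[of ?d] ax by simp
    then have "pos ?d = 0"
      using D3[of ?d] outer_free[OF mU] M_inner[OF mU] ax by simp
    \<comment> \<open>So the outer neighbour has negative weight, and the midpoint identity on the axis becomes strict.\<close>
    then have wd: "w ?d < 0"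
      using w_noncritical[of ?d] ax by (auto simp: pos_def max_def split: if_splits)
    then have wm: "w m < w ?a / 2"
      using w_axis_mid[OF m_axis m_odd] by simp
    have ic: "inner_charge m = w m"
      using w_eq_pos[OF mU] \<open>pos ?d = 0\<close> ax by (simp add: inner_charge_def outer_charge_def)
    show False
    proof (cases "?a \<in> E")
      case True
      then show False
        using inner_tight[OF mU] ic ax wm w_le_4[of ?a] by simp
    next
      case False
      then have a0: "?a \<noteq> (0, 0)" using origin by auto
      have "(\<Sum>p\<in>U. charge p ?a) \<le> charge (axis_succ ?a) ?a + charge (axis_pred ?a) ?a"
        using fin ax a0 charge_axis_eq_0[of ?a] U_odd by (intro sum_le_two) auto
      also have "\<dots> = w m + pos ?a / 2"
        using charge_axis[of ?a] a0 ax \<open>pos ?d = 0\<close> w_eq_pos[OF mU] by simp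
      also have "\<dots> < pos ?a"
        using wm w_le_pos[of ?a] by simp
      finally show False
        using D3[of ?a] False M_inner[OF mU] ax by simp
    qed
  qed
  \<comment> \<open>An odd point of minimal size off the axes leaves the capacity of its third neighbour unused.\<close>
  have "U = {}"
  proof (rule ccontr)
    assume "U \<noteq> {}"
    then obtain m where m: "m \<in> U" and min: "\<And>q. q \<in> U \<Longrightarrow> size1 m \<le> size1 q"
      using arg_min_if_finite[of U size1] fin by fastforce
    have m_odd: "\<not> even_cell m" and m_axis: "\<not> on_axis m"
      using m U_odd no_axis by auto
    let ?t = "third_cell m"
    note third = third_props[OF m_odd m_axis]
    have t_even: "even_cell ?t"
      using even_cell_nbrs[OF third(1)] m_odd by simp
    have "0 \<le> w m" using w_eq_pos[OF m] by simp
    then have wt: "0 < w ?t"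
      using w_le_third_cell[OF m_odd m_axis] w_noncritical[OF t_even third(4)] by simp
    have "?t \<in> M - E"
      using wt t_even third_free[OF m m_axis] by (auto simp: M_def pos_even_def)
    moreover have "charge q ?t = 0" if q: "q \<in> U" for q
    proof (rule charge_eq_0; rule)
      assume "inner_cell q = ?t"
      then show False
        using charged_third[OF m_odd m_axis U_odd[OF q]] no_axis[OF q] min[OF q] by auto
    next
      assume "outer_cell q = ?t"
      then show False
        using charged_third[OF m_odd m_axis U_odd[OF q]] no_axis[OF q] min[OF q] by auto
    qed
    ultimately have "pos ?t = 0"
      using D3[of ?t] by simp
    then show False using wt w_le_pos[of ?t] by simp
  qed
  then have IE: "I = E" and ME: "M = E \<union> pos_even"
    by (auto simp: E_def U_def M_def)
  have "E \<subseteq> pos_even"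
  proof
    fix p assume p: "p \<in> E"
    then have "0 \<le> w p" "even_cell p" using D1[OF p] pos_nonneg[of p] by (auto simp: E_def)
    then show "p \<in> pos_even"
      using w_noncritical[of p] w_origin by (cases "p = (0, 0)") (auto simp: pos_even_def)
  qed
  moreover have "p \<in> E" if "p \<in> pos_even" for p
  proof (rule ccontr)
    assume "p \<notin> E"
    then have "pos p = 0" using D3[of p] that ME \<open>U = {}\<close> by simp
    then show False using that by (simp add: pos_even_def pos_def max_def split: if_splits)
  qed
  ultimately show "I = pos_even" using IE by auto
qed

lemma gain_pos_even: "gain pos_even = (\<Sum>p\<in>pos_even. w p)"
proof -
  have "nbrs p \<inter> pos_even = {}" if "p \<in> pos_even" for p
    using that by (auto simp: pos_even_def dest: even_cell_nbrs)
  then show ?thesis by (simp add: gain_def)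
qed

end

section \<open>Unions of unit squares and their perimeter\<close>

text \<open>The lattice point with given integer coordinates.\<close>
definition pt :: "int \<times> int \<Rightarrow> real^2" where
  "pt p = vector [of_int (fst p), of_int (snd p)]"

lemma pt_nth [simp]: "pt p $ 1 = of_int (fst p)" "pt p $ 2 = of_int (snd p)"
  by (simp_all add: pt_def)

lemma pt_eq_iff [simp]: "pt p = pt q \<longleftrightarrow> p = q"
  by (auto simp: vec_eq_iff forall_2 prod_eq_iff)

lemma pt_origin: "pt (0, 0) = 0"
  by (simp add: vec_eq_iff forall_2)

lemma lattice2_eq: "lattice2 = range pt"
proof (intro equalityI subsetI)
  fix x :: "real^2" assume "x \<in> lattice2"
  then have "x $ 1 \<in> \<int>" "x $ 2 \<in> \<int>" by (simp_all add: lattice2_def)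
  then obtain a b where "x $ 1 = of_int a" "x $ 2 = of_int b" by (elim Ints_cases)
  then have "x = pt (a, b)" by (simp add: vec_eq_iff forall_2)
  then show "x \<in> range pt" by blast
next
  fix x :: "real^2" assume "x \<in> range pt"
  then show "x \<in> lattice2" by (elim rangeE) (simp add: lattice2_def)
qed

lemma pt_in_even_lattice2: "pt p \<in> even_lattice2 \<longleftrightarrow> even_cell p"
proof -
  have "pt p $ 1 + pt p $ 2 = 2 * of_int k \<longleftrightarrow> fst p + snd p = 2 * k" for k
  proof -
    have "pt p $ 1 + pt p $ 2 = real_of_int (fst p + snd p)" "2 * of_int k = real_of_int (2 * k)"
      by simp_all
    then show ?thesis by (simp only: of_int_eq_iff)
  qed
  then show ?thesis
    unfolding even_lattice2_def lattice2_eq by (simp add: even_cell_def dvd_def)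
qed

lemma even_lattice2_eq: "even_lattice2 = pt ` {p. even_cell p}"
proof (intro equalityI subsetI)
  fix x assume x: "x \<in> even_lattice2"
  then have "x \<in> range pt" unfolding even_lattice2_def lattice2_eq by simp
  then obtain p where "x = pt p" by blast
  then show "x \<in> pt ` {p. even_cell p}" using x pt_in_even_lattice2 by simp
next
  fix x assume "x \<in> pt ` {p. even_cell p}"
  then show "x \<in> even_lattice2" using pt_in_even_lattice2 by (elim imageE) simp
qed

lemma mem_unit_square:
  "z \<in> unit_square x \<longleftrightarrow> \<bar>z$1 - x$1\<bar> \<le> 1 / 2 \<and> \<bar>z$2 - x$2\<bar> \<le> 1 / 2"
proof -
  have "z \<in> unit_square x \<longleftrightarrow> z - x \<in> cbox (vec (-1/2)) (vec (1/2))"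
    unfolding unit_square_def by (force simp: image_iff)
  also have "\<dots> \<longleftrightarrow> \<bar>z$1 - x$1\<bar> \<le> 1 / 2 \<and> \<bar>z$2 - x$2\<bar> \<le> 1 / 2"
    unfolding mem_box_cart forall_2 abs_le_iff vec_component vector_minus_component by auto
  finally show ?thesis .
qed

lemma pt_in_unit_square [simp]: "pt p \<in> unit_square (pt q) \<longleftrightarrow> p = q"
proof -
  have "\<bar>real_of_int a - real_of_int b\<bar> \<le> 1 / 2 \<longleftrightarrow> a = b" for a b :: int
  proof
    assume "\<bar>real_of_int a - real_of_int b\<bar> \<le> 1 / 2"
    then have "\<bar>real_of_int (a - b)\<bar> < 1" by simp
    then have "\<bar>a - b\<bar> < 1" by linarith
    then show "a = b" by simp
  qed simp
  then show ?thesis by (simp add: mem_unit_square prod_eq_iff)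
qed

lemma centers_squares_union [simp]: "centers (squares_union (pt ` J)) = pt ` J"
  by (auto simp: centers_def squares_union_def lattice2_eq)

lemma lattice_sets_iff: "E \<in> lattice_sets \<longleftrightarrow> (\<exists>J. E = squares_union (pt ` J))"
  unfolding lattice_sets_def lattice2_eq by (auto simp: subset_image_iff)

text \<open>The unit edges separating \<open>J\<close> from its complement, each encoded by the lattice points on its two sides, the
one in \<open>J\<close> first.\<close>
definition boundary_pairs :: "(int \<times> int) set \<Rightarrow> ((int \<times> int) \<times> (int \<times> int)) set" where
  "boundary_pairs J = (SIGMA p:J. nbrs p - J)"

text \<open>Unit speed parametrization on \<open>[0, 1]\<close> of the common side of the squares centred at two adjacent lattice
points: it passes through their midpoint at time 1/2, orthogonally to their difference.\<close>
definition edge :: "(int \<times> int) \<times> (int \<times> int) \<Rightarrow> real \<Rightarrow> real^2" where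
  "edge e t = (let p = fst e; q = snd e in
     (1/2) *\<^sub>R (pt p + pt q) + (t - 1/2) *\<^sub>R pt (snd p - snd q, fst q - fst p))"

lemma edge_nth:
  "edge ((a, b), (c, d)) t $ 1 = real_of_int (a + c) / 2 + (t - 1/2) * real_of_int (b - d)"
  "edge ((a, b), (c, d)) t $ 2 = real_of_int (b + d) / 2 + (t - 1/2) * real_of_int (c - a)"
  by (simp_all add: edge_def Let_def)

lemma dist_edge:
  assumes "e \<in> boundary_pairs J"
  shows "dist (edge e s) (edge e t) = \<bar>s - t\<bar>"
proof -
  obtain p q where e: "e = (p, q)" by (cases e)
  have q: "q \<in> nbrs p" using assms by (simp add: e boundary_pairs_def)
  have "edge e s - edge e t = (s - t) *\<^sub>R pt (snd p - snd q, fst q - fst p)"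
    by (simp add: e edge_def Let_def algebra_simps)
  moreover have "norm (pt (snd p - snd q, fst q - fst p)) = 1"
    using q by (auto simp: nbrs_def norm_vec_def L2_set_def sum_2)
  ultimately show ?thesis by (simp add: dist_norm)
qed

lemma finite_boundary_pairs: "finite J \<Longrightarrow> finite (boundary_pairs J)"
  by (simp add: boundary_pairs_def)

lemma card_boundary_pairs: "finite J \<Longrightarrow> card (boundary_pairs J) = (\<Sum>p\<in>J. card (nbrs p - J))"
  by (simp add: boundary_pairs_def)

text \<open>Distinct boundary edges stay at distance at least \<open>\<eta>\<close> away from their endpoints. The same side cannot
occur twice with opposite orientations because exactly one of its two squares belongs to \<open>J\<close>.\<close>
lemma edge_separated:
  assumes e: "e \<in> boundary_pairs J" "e' \<in> boundary_pairs J" "e \<noteq> e'"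
    and \<eta>: "0 < \<eta>" "s \<in> {\<eta>..1 - \<eta>}" "t \<in> {\<eta>..1 - \<eta>}"
  shows "\<eta> \<le> dist (edge e s) (edge e' t)"
proof (rule ccontr)
  assume "\<not> ?thesis"
  then have less: "\<bar>edge e s $ 1 - edge e' t $ 1\<bar> < \<eta>" "\<bar>edge e s $ 2 - edge e' t $ 2\<bar> < \<eta>"
    using component_le_norm_cart[of "edge e s - edge e' t" 1]
      component_le_norm_cart[of "edge e s - edge e' t" 2]
    by (simp_all add: dist_norm)
  obtain a b c d where e1: "e = ((a, b), (c, d))" by (metis surj_pair)
  obtain a' b' c' d' where e2: "e' = ((a', b'), (c', d'))" by (metis surj_pair)
  have J: "(a, b) \<in> J" "(c, d) \<notin> J" "(a', b') \<in> J" "(c', d') \<notin> J"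
    using e by (auto simp: e1 e2 boundary_pairs_def)
  define u where "u = s - 1/2"
  define v where "v = t - 1/2"
  have uv: "\<bar>u\<bar> \<le> 1/2 - \<eta>" "\<bar>v\<bar> \<le> 1/2 - \<eta>"
    using \<eta> by (auto simp: u_def v_def)
  have less1: "\<bar>real_of_int (a + c) / 2 + u * real_of_int (b - d) -
      (real_of_int (a' + c') / 2 + v * real_of_int (b' - d'))\<bar> < \<eta>"
    and less2: "\<bar>real_of_int (b + d) / 2 + u * real_of_int (c - a) -
      (real_of_int (b' + d') / 2 + v * real_of_int (c' - a'))\<bar> < \<eta>"
    using less unfolding edge_nth e1 e2 u_def v_def .
  have same: "k = l" if "\<bar>real_of_int k - real_of_int l\<bar> < 1" for k l
    using that by linarith
  have aux: "\<bar>x - 2 * y\<bar> < 1" if "\<bar>x / 2 - (y + z)\<bar> < \<eta>" "\<bar>z\<bar> \<le> 1/2 - \<eta>" for x y z :: real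
    using that by arith
  have aux2: "\<bar>x - y\<bar> < 1" if "\<bar>x / 2 - y / 2\<bar> < \<eta>" "\<bar>z\<bar> \<le> 1/2 - \<eta>" for x y z :: real
    using that by arith
  have aux3: "\<bar>x - y\<bar> < 1" if "\<bar>x + z - (y + z')\<bar> < \<eta>" "\<bar>z\<bar> \<le> 1/2 - \<eta>" "\<bar>z'\<bar> \<le> 1/2 - \<eta>" "0 < \<eta>"
    for x y z z' :: real
    using that by arith
  have crossing: False
    if "c = a + 1 \<or> c = a - 1" "\<bar>real_of_int (a + c) / 2 - (real_of_int a' + v')\<bar> < \<eta>"
      "\<bar>v'\<bar> \<le> 1/2 - \<eta>" for a c a' v'
  proof -
    have "\<bar>real_of_int (a + c) - real_of_int (2 * a')\<bar> < 1" using aux that(2,3) by simp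
    then have "a + c = 2 * a'" by (rule same)
    with that(1) show False by presburger
  qed
  have parallel: "a + c = a' + c' \<and> b = b'"
    if "\<bar>real_of_int (a + c) / 2 - real_of_int (a' + c') / 2\<bar> < \<eta>" "\<bar>real_of_int b + u' - (real_of_int b' + v')\<bar> < \<eta>"
      "\<bar>u'\<bar> \<le> 1/2 - \<eta>" "\<bar>v'\<bar> \<le> 1/2 - \<eta>" for a c a' c' b b' u' v'
  proof -
    have "\<bar>real_of_int (a + c) - real_of_int (a' + c')\<bar> < 1" using aux2 that(1,3) by blast
    moreover have "\<bar>real_of_int b - real_of_int b'\<bar> < 1" using aux3 that(2-4) \<eta>(1) by blast
    ultimately show ?thesis using same by blast
  qed
  have nb: "d = b \<and> (c = a + 1 \<or> c = a - 1) \<or> c = a \<and> (d = b + 1 \<or> d = b - 1)"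
    and nb': "d' = b' \<and> (c' = a' + 1 \<or> c' = a' - 1) \<or> c' = a' \<and> (d' = b' + 1 \<or> d' = b' - 1)"
    using e by (auto simp: e1 e2 boundary_pairs_def nbrs_def)
  have scale: "\<bar>u * real_of_int (m - n)\<bar> \<le> 1/2 - \<eta>" "\<bar>v * real_of_int (m - n)\<bar> \<le> 1/2 - \<eta>"
    "\<bar>u * real_of_int (n - m)\<bar> \<le> 1/2 - \<eta>" "\<bar>v * real_of_int (n - m)\<bar> \<le> 1/2 - \<eta>"
    if "m = n + 1 \<or> m = n - 1" for m n :: int
    using that uv by auto
  consider (hh) "d = b" "c = a + 1 \<or> c = a - 1" "d' = b'" "c' = a' + 1 \<or> c' = a' - 1"
    | (vv) "c = a" "d = b + 1 \<or> d = b - 1" "c' = a'" "d' = b' + 1 \<or> d' = b' - 1"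
    | (hv) "d = b" "c = a + 1 \<or> c = a - 1" "c' = a'" "d' = b' + 1 \<or> d' = b' - 1"
    | (vh) "c = a" "d = b + 1 \<or> d = b - 1" "d' = b'" "c' = a' + 1 \<or> c' = a' - 1"
    using nb nb' by blast
  then show False
  proof cases
    case hh
    have "\<bar>real_of_int (a + c) / 2 - real_of_int (a' + c') / 2\<bar> < \<eta>"
      using less1 unfolding hh(1,3) by simp
    moreover have "\<bar>real_of_int b + u * real_of_int (c - a) - (real_of_int b' + v * real_of_int (c' - a'))\<bar> < \<eta>"
      using less2 unfolding hh(1,3) by simp
    ultimately have "a + c = a' + c' \<and> b = b'"
      using parallel scale(1)[OF hh(2)] scale(2)[OF hh(4)] by blast
    then have "a' = a \<and> c' = c \<or> a' = c" "b' = b" using hh(2,4) by auto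
    then show False using hh(1,3) J e(3) by (auto simp: e1 e2)
  next
    case vv
    have "\<bar>real_of_int (b + d) / 2 - real_of_int (b' + d') / 2\<bar> < \<eta>"
      using less2 unfolding vv(1,3) by simp
    moreover have "\<bar>real_of_int a + u * real_of_int (b - d) - (real_of_int a' + v * real_of_int (b' - d'))\<bar> < \<eta>"
      using less1 unfolding vv(1,3) by simp
    ultimately have "b + d = b' + d' \<and> a = a'"
      using parallel scale(3)[OF vv(2)] scale(4)[OF vv(4)] by blast
    then have "b' = b \<and> d' = d \<or> b' = d" "a' = a" using vv(2,4) by auto
    then show False using vv(1,3) J e(3) by (auto simp: e1 e2)
  next
    case hv
    have "\<bar>real_of_int (a + c) / 2 - (real_of_int a' + v * real_of_int (b' - d'))\<bar> < \<eta>"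
      using less1 unfolding hv(1,3) by simp
    then show False
      using crossing[OF hv(2)] scale(4)[OF hv(4)] by blast
  next
    case vh
    have "\<bar>real_of_int (a' + c') / 2 - (real_of_int a + u * real_of_int (b - d))\<bar> < \<eta>"
      using less1 unfolding vh(1,3) by (simp add: abs_minus_commute)
    then show False
      using crossing[OF vh(4)] scale(3)[OF vh(2)] by blast
  qed
qed

lemma closed_unit_square: "closed (unit_square x)"
  unfolding unit_square_def by (intro closed_translation closed_cbox)

lemma in_some_unit_square:
  obtains r where "z \<in> unit_square (pt r)"
proof
  show "z \<in> unit_square (pt (round (z $ 1), round (z $ 2)))"
    using of_int_round_abs_le[of "z $ 1"] of_int_round_abs_le[of "z $ 2"]
    by (simp add: mem_unit_square abs_minus_commute)
qed

lemma common_side: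
  assumes "q \<in> nbrs p" "z \<in> unit_square (pt p)" "z \<in> unit_square (pt q)"
  shows "z \<in> edge (p, q) ` {0..1}"
proof -
  obtain a b c d where pq: "p = (a, b)" "q = (c, d)" by (metis surj_pair)
  have z: "\<bar>z $ 1 - a\<bar> \<le> 1/2" "\<bar>z $ 2 - b\<bar> \<le> 1/2" "\<bar>z $ 1 - c\<bar> \<le> 1/2" "\<bar>z $ 2 - d\<bar> \<le> 1/2"
    using assms(2,3) by (simp_all add: mem_unit_square pq)
  have bounds: "0 \<le> 1/2 + u \<and> 1/2 + u \<le> 1 \<and> 0 \<le> 1/2 - u \<and> 1/2 - u \<le> 1" if "\<bar>u\<bar> \<le> 1/2" for u :: real
    using that by (intro conjI; linarith)
  have eqI: ?thesis if "z $ 1 = edge (p, q) t $ 1" "z $ 2 = edge (p, q) t $ 2" "0 \<le> t" "t \<le> 1" for t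
    using that by (intro image_eqI[of _ _ t]) (simp_all add: vec_eq_iff forall_2)
  consider "c = a + 1" "d = b" | "c = a - 1" "d = b" | "c = a" "d = b + 1" | "c = a" "d = b - 1"
    using assms(1) by (auto simp: nbrs_def pq)
  then show ?thesis
  proof cases
    case 1
    have "z $ 1 = real_of_int a + 1/2"
      using z(1,3) unfolding 1 of_int_add of_int_diff of_int_1 by linarith
    then show ?thesis using bounds[OF z(2)]
      by (intro eqI[of "1/2 + (z $ 2 - b)"]) (auto simp: pq edge_nth 1)
  next
    case 2
    have "z $ 1 = real_of_int a - 1/2"
      using z(1,3) unfolding 2 of_int_add of_int_diff of_int_1 by linarith
    then show ?thesis using bounds[OF z(2)]
      by (intro eqI[of "1/2 - (z $ 2 - b)"]) (auto simp: pq edge_nth 2)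
  next
    case 3
    have "z $ 2 = real_of_int b + 1/2"
      using z(2,4) unfolding 3 of_int_add of_int_diff of_int_1 by linarith
    then show ?thesis using bounds[OF z(1)]
      by (intro eqI[of "1/2 - (z $ 1 - a)"]) (auto simp: pq edge_nth 3)
  next
    case 4
    have "z $ 2 = real_of_int b - 1/2"
      using z(2,4) unfolding 4 of_int_add of_int_diff of_int_1 by linarith
    then show ?thesis using bounds[OF z(1)]
      by (intro eqI[of "1/2 + (z $ 1 - a)"]) (auto simp: pq edge_nth 4)
  qed
qed

lemma frontier_subset_edges:
  assumes "finite J"
  shows "frontier (squares_union (pt ` J)) \<subseteq> (\<Union>e\<in>boundary_pairs J. edge e ` {0..1})"
proof
  let ?E = "squares_union (pt ` J)"
  fix z assume z: "z \<in> frontier ?E"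
  have "closed ?E"
    unfolding squares_union_def using assms closed_unit_square by (intro closed_UN) auto
  then have "z \<in> ?E" "z \<notin> interior ?E"
    using z by (auto simp: frontier_def)
  then obtain p where p: "p \<in> J" "z \<in> unit_square (pt p)"
    by (auto simp: squares_union_def)
  show "z \<in> (\<Union>e\<in>boundary_pairs J. edge e ` {0..1})"
  proof (rule ccontr)
    assume neg: "z \<notin> (\<Union>e\<in>boundary_pairs J. edge e ` {0..1})"
    \<comment> \<open>If \<open>z\<close> is on no boundary edge, then membership in \<open>J\<close> spreads to all squares
      containing \<open>z\<close>, and \<open>z\<close> is an interior point.\<close>
    have step: "q \<in> J" if "p \<in> J" "z \<in> unit_square (pt p)" "z \<in> unit_square (pt q)" "q = p \<or> q \<in> nbrs p" for p q
    proof (rule ccontr)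
      assume "q \<notin> J"
      then have "(p, q) \<in> boundary_pairs J" "q \<in> nbrs p" using that by (auto simp: boundary_pairs_def)
      then show False using common_side[OF _ that(2,3)] neg by blast
    qed
    have all: "r \<in> J" if r: "z \<in> unit_square (pt r)" for r
    proof -
      have near: "m = k \<or> m = k + 1 \<or> m = k - 1" if "\<bar>x - real_of_int k\<bar> \<le> 1/2" "\<bar>x - real_of_int m\<bar> \<le> 1/2" for x k m
        using that by linarith
      let ?m = "(fst r, snd p)"
      have m: "z \<in> unit_square (pt ?m)"
        using p(2) r by (simp add: mem_unit_square)
      have "?m = p \<or> ?m \<in> nbrs p"
        using near[of "z $ 1" "fst p" "fst r"] p(2) r
        by (cases p; cases r) (auto simp: nbrs_def mem_unit_square)
      then have "?m \<in> J" using step p m by blast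
      moreover have "r = ?m \<or> r \<in> nbrs ?m"
        using near[of "z $ 2" "snd p" "snd r"] p(2) r
        by (cases p; cases r) (auto simp: nbrs_def mem_unit_square)
      ultimately show ?thesis using step m r by blast
    qed
    have near_floor: "\<lfloor>x\<rfloor> - 3 \<le> m \<and> m \<le> \<lfloor>x\<rfloor> + 3" if "\<bar>x - real_of_int m\<bar> \<le> 2" for x m
      using that floor_le_iff[of x "m + 3"] le_floor_iff[of "m - 3" x] by auto
    define K where "K = ({\<lfloor>z $ 1\<rfloor> - 3..\<lfloor>z $ 1\<rfloor> + 3} \<times> {\<lfloor>z $ 2\<rfloor> - 3..\<lfloor>z $ 2\<rfloor> + 3}) - J"
    define U where "U = ball z 1 - (\<Union>r\<in>K. unit_square (pt r))"
    have "open U"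
      unfolding U_def K_def using closed_unit_square by (intro open_Diff open_ball closed_UN) auto
    moreover have "z \<in> U"
      using all by (auto simp: U_def K_def)
    moreover have "U \<subseteq> ?E"
    proof
      fix y assume y: "y \<in> U"
      obtain r where r: "y \<in> unit_square (pt r)" by (rule in_some_unit_square)
      have "\<bar>y $ 1 - z $ 1\<bar> < 1" "\<bar>y $ 2 - z $ 2\<bar> < 1"
        using y component_le_norm_cart[of "y - z" 1] component_le_norm_cart[of "y - z" 2]
        by (auto simp: U_def dist_norm norm_minus_commute)
      then have "\<bar>z $ 1 - fst r\<bar> \<le> 2" "\<bar>z $ 2 - snd r\<bar> \<le> 2"
        using r unfolding mem_unit_square pt_nth by linarith+
      then have "r \<in> {\<lfloor>z $ 1\<rfloor> - 3..\<lfloor>z $ 1\<rfloor> + 3} \<times> {\<lfloor>z $ 2\<rfloor> - 3..\<lfloor>z $ 2\<rfloor> + 3}"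
        using near_floor by (simp add: mem_Times_iff)
      moreover have "r \<notin> K" using y r by (auto simp: U_def)
      ultimately have "r \<in> J" by (simp add: K_def)
      then show "y \<in> ?E" using r by (auto simp: squares_union_def)
    qed
    ultimately have "z \<in> interior ?E" by (rule interiorI)
    with \<open>z \<notin> interior ?E\<close> show False by simp
  qed
qed

lemma edge_subset_frontier:
  assumes "e \<in> boundary_pairs J"
  shows "edge e ` {0<..<1} \<subseteq> frontier (squares_union (pt ` J))"
proof
  let ?E = "squares_union (pt ` J)"
  fix z assume "z \<in> edge e ` {0<..<1}"
  then obtain t where t: "0 < t" "t < 1" "z = edge e t" by auto
  obtain a b c d where e: "e = ((a, b), (c, d))" by (metis surj_pair)
  have J: "(a, b) \<in> J" "(c, d) \<notin> J" and nbr: "(c, d) \<in> nbrs (a, b)"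
    using assms by (auto simp: e boundary_pairs_def)
  have cases: "c = a + 1 \<and> d = b \<or> c = a - 1 \<and> d = b \<or> c = a \<and> d = b + 1 \<or> c = a \<and> d = b - 1"
    using nbr by (auto simp: nbrs_def)
  have "z \<in> unit_square (pt (a, b))"
    using cases t(1,2) by (auto simp: mem_unit_square t(3) e edge_nth abs_le_iff field_simps)
  then have "z \<in> ?E" using J(1) by (auto simp: squares_union_def)
  moreover have "z \<notin> interior ?E"
  proof
    assume "z \<in> interior ?E"
    then obtain \<epsilon> where \<epsilon>: "0 < \<epsilon>" "ball z \<epsilon> \<subseteq> ?E" by (auto simp: mem_interior)
    define s where "s = min (\<epsilon> / 2) (1 / 4)"
    have s: "0 < s" "s < \<epsilon>" "s \<le> 1 / 4" using \<epsilon>(1) by (auto simp: s_def)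
    \<comment> \<open>Crossing the edge by a small amount leads to the interior of a square outside \<open>J\<close>.\<close>
    define y where "y = z + s *\<^sub>R pt (c - a, d - b)"
    have "norm (pt (c - a, d - b)) = 1"
      using cases by (auto simp: norm_vec_def L2_set_def sum_2)
    then have "y \<in> ball z \<epsilon>" using s by (simp add: y_def dist_norm)
    then obtain i j where r: "(i, j) \<in> J" "y \<in> unit_square (pt (i, j))"
      using \<epsilon>(2) by (auto simp: squares_union_def)
    have y: "\<bar>y $ 1 - i\<bar> \<le> 1/2" "\<bar>y $ 2 - j\<bar> \<le> 1/2"
      using r(2) by (simp_all add: mem_unit_square)
    have int_eq: "k = l" if "\<bar>x - real_of_int k\<bar> \<le> 1/2" "\<bar>x - real_of_int l\<bar> < 1/2" for x k l
      using that by linarith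
    have "\<bar>y $ 1 - c\<bar> < 1/2" "\<bar>y $ 2 - d\<bar> < 1/2"
      using cases s t(1,2) by (auto simp: y_def t(3) e edge_nth abs_less_iff field_simps)
    then have "i = c" "j = d" using int_eq y by blast+
    then show False using r(1) J(2) by simp
  qed
  ultimately show "z \<in> frontier ?E"
    using closure_subset by (auto simp: frontier_def)
qed

lemma hausdorff1_frontier:
  assumes "finite J"
  shows "hausdorff1 (frontier (squares_union (pt ` J))) = of_nat (\<Sum>p\<in>J. card (nbrs p - J))"
proof -
  have "hausdorff1 (frontier (squares_union (pt ` J))) = of_nat (card (boundary_pairs J))"
  proof (rule antisym)
    show "hausdorff1 (frontier (squares_union (pt ` J))) \<le> of_nat (card (boundary_pairs J))"
      using dist_edge by (intro hausdorff1_le_card[OF finite_boundary_pairs[OF assms] _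
            frontier_subset_edges[OF assms]]) simp
    show "of_nat (card (boundary_pairs J)) \<le> hausdorff1 (frontier (squares_union (pt ` J)))"
      by (rule hausdorff1_ge_card[OF finite_boundary_pairs[OF assms] dist_edge edge_separated
            edge_subset_frontier])
  qed
  then show ?thesis using card_boundary_pairs[OF assms] by simp
qed

section \<open>Absolute norms and the energy\<close>

lemma absolute_normD:
  assumes "absolute_norm \<phi>"
  shows "0 \<le> \<phi> x" "\<phi> x = 0 \<longleftrightarrow> x = 0" "\<phi> (c *\<^sub>R x) = \<bar>c\<bar> * \<phi> x" "\<phi> (x + y) \<le> \<phi> x + \<phi> y"
    "\<bar>x$1\<bar> = \<bar>y$1\<bar> \<Longrightarrow> \<bar>x$2\<bar> = \<bar>y$2\<bar> \<Longrightarrow> \<phi> x = \<phi> y"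
proof -
  note n = assms[unfolded absolute_norm_def]
  show "0 \<le> \<phi> x" using n by blast
  show "\<phi> x = 0 \<longleftrightarrow> x = 0" using n by blast
  show "\<phi> (c *\<^sub>R x) = \<bar>c\<bar> * \<phi> x" using n by blast
  show "\<phi> (x + y) \<le> \<phi> x + \<phi> y" using n by blast
  show "\<bar>x$1\<bar> = \<bar>y$1\<bar> \<Longrightarrow> \<bar>x$2\<bar> = \<bar>y$2\<bar> \<Longrightarrow> \<phi> x = \<phi> y" using n by blast
qed

lemma absolute_norm_combination:
  assumes "absolute_norm \<phi>" "0 \<le> u" "0 \<le> v"
  shows "\<phi> (u *\<^sub>R x + v *\<^sub>R y) \<le> u * \<phi> x + v * \<phi> y"
  using absolute_normD(4)[OF assms(1), of "u *\<^sub>R x" "v *\<^sub>R y"] assms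
  by (simp add: absolute_normD(3)[OF assms(1)])

text \<open>Monotonicity in the first coordinate: \<open>x\<close> is a convex combination of \<open>y\<close> and its mirror image
\<open>y'\<close>, which has the same norm.\<close>
lemma absolute_norm_mono1:
  assumes "absolute_norm \<phi>" "\<bar>x$1\<bar> \<le> \<bar>y$1\<bar>" "x$2 = y$2"
  shows "\<phi> x \<le> \<phi> y"
proof (cases "y$1 = 0")
  case True
  then have "x = y" using assms by (simp add: vec_eq_iff forall_2)
  then show ?thesis by simp
next
  case False
  define y' :: "real^2" where "y' = vector [- y$1, y$2]"
  define u where "u = (1 + x$1 / y$1) / 2"
  have "\<bar>x$1 / y$1\<bar> \<le> 1" using assms(2) False by (simp add: abs_divide divide_le_eq_1)
  then have u: "0 \<le> u" "0 \<le> 1 - u" by (simp_all add: u_def abs_le_iff del: abs_divide)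
  have "u * y$1 - (1 - u) * y$1 = x$1" using False by (simp add: u_def algebra_simps)
  then have "x = u *\<^sub>R y + (1 - u) *\<^sub>R y'"
    using assms(3) by (simp add: vec_eq_iff forall_2 y'_def) (simp add: algebra_simps)
  then have "\<phi> x \<le> u * \<phi> y + (1 - u) * \<phi> y'"
    using absolute_norm_combination[OF assms(1) u] by simp
  also have "\<phi> y' = \<phi> y"
    by (rule absolute_normD(5)[OF assms(1)]) (simp_all add: y'_def)
  finally show ?thesis by (simp add: algebra_simps)
qed

lemma absolute_norm_mono2:
  assumes "absolute_norm \<phi>" "\<bar>x$2\<bar> \<le> \<bar>y$2\<bar>" "x$1 = y$1"
  shows "\<phi> x \<le> \<phi> y"
proof (cases "y$2 = 0")
  case True
  then have "x = y" using assms by (simp add: vec_eq_iff forall_2)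
  then show ?thesis by simp
next
  case False
  define y' :: "real^2" where "y' = vector [y$1, - y$2]"
  define u where "u = (1 + x$2 / y$2) / 2"
  have "\<bar>x$2 / y$2\<bar> \<le> 1" using assms(2) False by (simp add: abs_divide divide_le_eq_1)
  then have u: "0 \<le> u" "0 \<le> 1 - u" by (simp_all add: u_def abs_le_iff del: abs_divide)
  have "u * y$2 - (1 - u) * y$2 = x$2" using False by (simp add: u_def algebra_simps)
  then have "x = u *\<^sub>R y + (1 - u) *\<^sub>R y'"
    using assms(3) by (simp add: vec_eq_iff forall_2 y'_def) (simp add: algebra_simps)
  then have "\<phi> x \<le> u * \<phi> y + (1 - u) * \<phi> y'"
    using absolute_norm_combination[OF assms(1) u] by simp
  also have "\<phi> y' = \<phi> y"
    by (rule absolute_normD(5)[OF assms(1)]) (simp_all add: y'_def)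
  finally show ?thesis by (simp add: algebra_simps)
qed

lemma absolute_norm_mono:
  assumes "absolute_norm \<phi>" "\<bar>x$1\<bar> \<le> \<bar>y$1\<bar>" "\<bar>x$2\<bar> \<le> \<bar>y$2\<bar>"
  shows "\<phi> x \<le> \<phi> y"
proof -
  define z :: "real^2" where "z = vector [x$1, y$2]"
  have "\<phi> x \<le> \<phi> z" using assms by (intro absolute_norm_mono2[OF assms(1)]) (simp_all add: z_def)
  also have "\<dots> \<le> \<phi> y" using assms by (intro absolute_norm_mono1[OF assms(1)]) (simp_all add: z_def)
  finally show ?thesis .
qed

lemma pt_scale: "pt (x, 0) = of_int x *\<^sub>R pt (1, 0)" "pt (0, x) = of_int x *\<^sub>R pt (0, 1)"
  by (simp_all add: vec_eq_iff forall_2)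

lemma absolute_norm_axis:
  assumes "absolute_norm \<phi>" "0 \<le> k"
  shows "\<phi> (pt (k, 0)) = of_int k * \<phi> (pt (1, 0))" "\<phi> (pt (0, k)) = of_int k * \<phi> (pt (0, 1))"
  unfolding pt_scale[of k] absolute_normD(3)[OF assms(1)] using assms(2) by simp_all

text \<open>The points \<open>(x, y)\<close> and \<open>(x+1, y+1)\<close> are nonnegative combinations of \<open>P = (x+1, y)\<close> and
\<open>Q = (x, y+1)\<close> whose coefficients add up to 1 for \<open>P\<close> and for \<open>Q\<close>.\<close>
lemma absolute_norm_submodular:
  assumes "absolute_norm \<phi>" "0 \<le> x" "0 \<le> y"
  shows "\<phi> (pt (x, y)) + \<phi> (pt (x + 1, y + 1)) \<le> \<phi> (pt (x + 1, y)) + \<phi> (pt (x, y + 1))"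
proof -
  let ?P = "pt (x + 1, y)" and ?Q = "pt (x, y + 1)"
  define n where "n = real_of_int x + real_of_int y + 1"
  define u where "u = real_of_int x / n"
  define v where "v = real_of_int y / n"
  have n: "0 < n" using assms by (simp add: n_def)
  have uv: "0 \<le> u" "0 \<le> v" "0 \<le> 1 - u" "0 \<le> 1 - v"
    using assms n by (auto simp: u_def v_def n_def)
  have split: "a / n * (a + 1) + b / n * a = a" if "n = a + b + 1" for a b
  proof -
    have "a / n * (a + 1) + b / n * a = a * n / n"
      unfolding that by (simp add: add_divide_distrib algebra_simps)
    then show ?thesis using n by simp
  qed
  have "real_of_int x = u * (real_of_int x + 1) + v * real_of_int x"
    "real_of_int y = u * real_of_int y + v * (real_of_int y + 1)"
    using split[of "real_of_int x" "real_of_int y"] split[of "real_of_int y" "real_of_int x"]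
    by (simp_all add: n_def u_def v_def)
  then have A: "pt (x, y) = u *\<^sub>R ?P + v *\<^sub>R ?Q"
    by (simp add: vec_eq_iff forall_2)
  have "pt (x + 1, y + 1) = ?P + ?Q - pt (x, y)"
    by (simp add: vec_eq_iff forall_2)
  also have "\<dots> = (1 - u) *\<^sub>R ?P + (1 - v) *\<^sub>R ?Q"
    unfolding A by (simp add: algebra_simps)
  finally have D: "pt (x + 1, y + 1) = (1 - u) *\<^sub>R ?P + (1 - v) *\<^sub>R ?Q" .
  have "\<phi> (pt (x, y)) \<le> u * \<phi> ?P + v * \<phi> ?Q"
    unfolding A using absolute_norm_combination[OF assms(1)] uv by blast
  moreover have "\<phi> (pt (x + 1, y + 1)) \<le> (1 - u) * \<phi> ?P + (1 - v) * \<phi> ?Q"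
    unfolding D using absolute_norm_combination[OF assms(1)] uv by blast
  ultimately show ?thesis by (simp add: algebra_simps)
qed

lemma finite_lattice_ball:
  assumes "absolute_norm \<phi>"
  shows "finite {p. \<phi> (pt p) < r}"
proof -
  have pos: "0 < \<phi> (pt (1, 0))" "0 < \<phi> (pt (0, 1))"
    using absolute_normD(1,2)[OF assms] pt_eq_iff[of _ "(0, 0)"] unfolding pt_origin
    by (metis less_eq_real_def zero_neq_one prod.inject)+
  define m where "m = min (\<phi> (pt (1, 0))) (\<phi> (pt (0, 1)))"
  have m: "0 < m" using pos by (simp add: m_def)
  define N where "N = \<lceil>r / m\<rceil>"
  have "- N \<le> x \<and> x \<le> N \<and> - N \<le> y \<and> y \<le> N" if "\<phi> (pt (x, y)) < r" for x y
  proof -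
    have "\<bar>of_int x\<bar> * m \<le> \<bar>of_int x\<bar> * \<phi> (pt (1, 0))" "\<bar>of_int y\<bar> * m \<le> \<bar>of_int y\<bar> * \<phi> (pt (0, 1))"
      by (intro mult_left_mono; simp add: m_def)+
    moreover have "\<bar>of_int x\<bar> * \<phi> (pt (1, 0)) = \<phi> (pt (x, 0))" "\<bar>of_int y\<bar> * \<phi> (pt (0, 1)) = \<phi> (pt (0, y))"
      by (simp_all add: pt_scale[of x] pt_scale[of y] absolute_normD(3)[OF assms])
    moreover have "\<phi> (pt (x, 0)) \<le> \<phi> (pt (x, y))" "\<phi> (pt (0, y)) \<le> \<phi> (pt (x, y))"
      by (intro absolute_norm_mono[OF assms]; simp)+
    ultimately have "real_of_int \<bar>x\<bar> * m \<le> r" "real_of_int \<bar>y\<bar> * m \<le> r" using that by auto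
    then have "real_of_int \<bar>x\<bar> \<le> r / m" "real_of_int \<bar>y\<bar> \<le> r / m"
      using m by (simp_all add: pos_le_divide_eq)
    then have "\<bar>x\<bar> \<le> N" "\<bar>y\<bar> \<le> N" unfolding N_def by linarith+
    then show ?thesis by linarith
  qed
  then have "{p. \<phi> (pt p) < r} \<subseteq> {-N..N} \<times> {-N..N}" by auto
  then show ?thesis by (rule finite_subset) simp
qed

text \<open>What the square centred at \<open>p\<close> contributes to minus the energy when none of its neighbours is present.\<close>
definition weight :: "(real^2 \<Rightarrow> real) \<Rightarrow> real \<Rightarrow> int \<times> int \<Rightarrow> real" where
  "weight \<phi> \<alpha> p = 4 - \<alpha> * \<phi> (pt p)"

lemma weight_checkerboard:
  assumes \<phi>: "absolute_norm \<phi>" and \<alpha>: "\<alpha> > 0" and crit: "\<alpha> \<notin> critical_values \<phi>"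
  shows "checkerboard_weight (weight \<phi> \<alpha>)"
proof
  note \<phi>D = absolute_normD[OF \<phi>]
  have zero: "\<phi> (pt p) = 0 \<longleftrightarrow> p = (0, 0)" for p
    using \<phi>D(2) pt_eq_iff[of p "(0, 0)"] unfolding pt_origin by simp
  then have pos: "0 < \<phi> (pt p)" if "p \<noteq> (0, 0)" for p
    using that \<phi>D(1)[of "pt p"] by (metis less_eq_real_def)
  note axis = absolute_norm_axis[OF \<phi>]
  show "weight \<phi> \<alpha> (x, y) = weight \<phi> \<alpha> (\<bar>x\<bar>, \<bar>y\<bar>)" for x y
    using \<phi>D(5)[of "pt (x, y)" "pt (\<bar>x\<bar>, \<bar>y\<bar>)"] by (simp add: weight_def)
  show "weight \<phi> \<alpha> (0, 0) = 4"
    using zero by (simp add: weight_def)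
  show "weight \<phi> \<alpha> p < 4" if "p \<noteq> (0, 0)" for p
    using pos[OF that] \<alpha> by (simp add: weight_def)
  show "weight \<phi> \<alpha> (x', y') \<le> weight \<phi> \<alpha> (x, y)" if "0 \<le> x" "x \<le> x'" "0 \<le> y" "y \<le> y'" for x x' y y'
    using absolute_norm_mono[OF \<phi>, of "pt (x, y)" "pt (x', y')"] that \<alpha> by (simp add: weight_def)
  show "2 * weight \<phi> \<alpha> (x, 0) = weight \<phi> \<alpha> (x - 1, 0) + weight \<phi> \<alpha> (x + 1, 0)" if "0 < x" for x
  proof -
    have "2 * \<phi> (pt (x, 0)) = \<phi> (pt (x - 1, 0)) + \<phi> (pt (x + 1, 0))"
      using that axis(1)[of x] axis(1)[of "x - 1"] axis(1)[of "x + 1"] by (simp add: algebra_simps)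
    then have "\<alpha> * (2 * \<phi> (pt (x, 0))) = \<alpha> * (\<phi> (pt (x - 1, 0)) + \<phi> (pt (x + 1, 0)))" by (rule arg_cong)
    then show ?thesis by (simp add: weight_def distrib_left)
  qed
  show "2 * weight \<phi> \<alpha> (0, y) = weight \<phi> \<alpha> (0, y - 1) + weight \<phi> \<alpha> (0, y + 1)" if "0 < y" for y
  proof -
    have "2 * \<phi> (pt (0, y)) = \<phi> (pt (0, y - 1)) + \<phi> (pt (0, y + 1))"
      using that axis(2)[of y] axis(2)[of "y - 1"] axis(2)[of "y + 1"] by (simp add: algebra_simps)
    then have "\<alpha> * (2 * \<phi> (pt (0, y))) = \<alpha> * (\<phi> (pt (0, y - 1)) + \<phi> (pt (0, y + 1)))" by (rule arg_cong)
    then show ?thesis by (simp add: weight_def distrib_left)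
  qed
  show "weight \<phi> \<alpha> (x + 1, y) + weight \<phi> \<alpha> (x, y + 1) \<le> weight \<phi> \<alpha> (x, y) + weight \<phi> \<alpha> (x + 1, y + 1)"
    if "0 \<le> x" "0 \<le> y" for x y
    using mult_left_mono[OF absolute_norm_submodular[OF \<phi> that] less_imp_le[OF \<alpha>]]
    by (simp add: weight_def algebra_simps)
  show "2 * weight \<phi> \<alpha> (x, y) - 4 \<le> weight \<phi> \<alpha> (x + 1, y)" if "0 < x" "0 \<le> y" for x y
  proof -
    have "pt (x + 1, y) = pt (x, y) + pt (1, 0)" by (simp add: vec_eq_iff forall_2)
    then have "\<phi> (pt (x + 1, y)) \<le> \<phi> (pt (x, y)) + \<phi> (pt (1, 0))" using \<phi>D(4) by simp
    also have "\<phi> (pt (1, 0)) \<le> \<phi> (pt (x, y))"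
      using that by (intro absolute_norm_mono[OF \<phi>]) auto
    finally show ?thesis
      using mult_left_mono[of "\<phi> (pt (x + 1, y))" "2 * \<phi> (pt (x, y))" \<alpha>] \<alpha> by (simp add: weight_def)
  qed
  show "2 * weight \<phi> \<alpha> (x, y) - 4 \<le> weight \<phi> \<alpha> (x, y + 1)" if "0 \<le> x" "0 < y" for x y
  proof -
    have "pt (x, y + 1) = pt (x, y) + pt (0, 1)" by (simp add: vec_eq_iff forall_2)
    then have "\<phi> (pt (x, y + 1)) \<le> \<phi> (pt (x, y)) + \<phi> (pt (0, 1))" using \<phi>D(4) by simp
    also have "\<phi> (pt (0, 1)) \<le> \<phi> (pt (x, y))"
      using that by (intro absolute_norm_mono[OF \<phi>]) auto
    finally show ?thesis
      using mult_left_mono[of "\<phi> (pt (x, y + 1))" "2 * \<phi> (pt (x, y))" \<alpha>] \<alpha> by (simp add: weight_def)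
  qed
  show "weight \<phi> \<alpha> p \<noteq> 0" if "even_cell p" "p \<noteq> (0, 0)" for p
  proof
    assume "weight \<phi> \<alpha> p = 0"
    then have "\<alpha> = 4 / \<phi> (pt p)" using pos[OF that(2)] by (simp add: weight_def field_simps)
    moreover have "pt p \<in> even_lattice2 - {0}"
      using that pt_eq_iff[of p "(0, 0)"] unfolding pt_origin by (simp add: pt_in_even_lattice2)
    ultimately show False using crit unfolding critical_values_def by blast
  qed
  have "{p. 0 < weight \<phi> \<alpha> p} = {p. \<phi> (pt p) < 4 / \<alpha>}"
    using \<alpha> by (simp add: weight_def pos_less_divide_eq mult.commute)
  then show "finite {p. 0 < weight \<phi> \<alpha> p}"
    using finite_lattice_ball[OF \<phi>] by simp
qed

lemma unit_square_0: "unit_square 0 = squares_union (pt ` {(0, 0)})"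
  by (simp add: squares_union_def pt_origin)

lemma boundary_dist_origin:
  assumes "p \<noteq> (0, 0)"
  shows "boundary_dist \<phi> (pt p) (unit_square 0) = ennreal (\<phi> (pt p))"
proof -
  have "centers (unit_square 0) = {0}"
    unfolding unit_square_0 centers_squares_union by (simp add: pt_origin)
  moreover have "pt p \<noteq> 0" using assms pt_eq_iff[of p "(0, 0)"] unfolding pt_origin by simp
  ultimately show ?thesis by (simp add: boundary_dist_def)
qed

lemma sym_diff_centers:
  assumes "(0, 0) \<in> J"
  shows "sym_diff (centers (squares_union (pt ` J))) (centers (unit_square 0)) = pt ` (J - {(0, 0)})"
  unfolding unit_square_0 centers_squares_union using assms by auto

lemma energy_finite:
  assumes \<phi>: "absolute_norm \<phi>" and \<alpha>: "\<alpha> > 0" and J: "finite J" "(0, 0) \<in> J"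
    and w: "checkerboard_weight (weight \<phi> \<alpha>)"
  shows "energy \<phi> \<alpha> (squares_union (pt ` J)) (unit_square 0) =
    ereal (- checkerboard_weight.gain (weight \<phi> \<alpha>) J)"
proof -
  note \<phi>D = absolute_normD[OF \<phi>]
  let ?S = "\<Sum>p\<in>J - {(0, 0)}. \<phi> (pt p)" and ?n = "\<Sum>p\<in>J. card (nbrs p - J)"
  have "(\<Sum>\<^sub>\<infinity>i\<in>pt ` (J - {(0, 0)}). boundary_dist \<phi> i (unit_square 0)) =
      (\<Sum>i\<in>pt ` (J - {(0, 0)}). boundary_dist \<phi> i (unit_square 0))"
    using J by (intro infsum_finite) simp
  also have "\<dots> = (\<Sum>p\<in>J - {(0, 0)}. boundary_dist \<phi> (pt p) (unit_square 0))"
    by (intro sum.reindex_cong[of pt]) (auto simp: inj_on_def)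
  also have "\<dots> = (\<Sum>p\<in>J - {(0, 0)}. ennreal (\<phi> (pt p)))"
    by (intro sum.cong refl boundary_dist_origin) auto
  also have "\<dots> = ennreal ?S"
    using \<phi>D(1) by (intro sum_ennreal)
  finally have diss: "(\<Sum>\<^sub>\<infinity>i\<in>pt ` (J - {(0, 0)}). boundary_dist \<phi> i (unit_square 0)) = ennreal ?S" .
  have S: "0 \<le> ?S" using \<phi>D(1) by (intro sum_nonneg)
  have perimeter: "enn2ereal (hausdorff1 (frontier (squares_union (pt ` J)))) = ereal (real ?n)"
    unfolding hausdorff1_frontier[OF J(1)] ennreal_of_nat_eq_real_of_nat
    by (rule enn2ereal_ennreal[OF of_nat_0_le_iff])
  have "energy \<phi> \<alpha> (squares_union (pt ` J)) (unit_square 0) = ereal (- real ?n + \<alpha> * ?S)"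
    unfolding energy_def sym_diff_centers[OF J(2)] diss perimeter enn2ereal_ennreal[OF S]
      uminus_ereal.simps times_ereal.simps plus_ereal.simps ..
  also have "- real ?n + \<alpha> * ?S = - checkerboard_weight.gain (weight \<phi> \<alpha>) J"
  proof -
    have "\<phi> (pt (0, 0)) = 0" using \<phi>D(2) by (simp add: pt_origin)
    then have "?S = (\<Sum>p\<in>J. \<phi> (pt p))"
      using J by (simp add: sum.remove)
    moreover have "real (card (nbrs p - J)) = 4 - real (card (nbrs p \<inter> J))" for p
    proof -
      have "card (nbrs p) = card (nbrs p \<inter> J) + card (nbrs p - J)"
        using card_Int_Diff[of "nbrs p" J] by simp
      then show ?thesis using card_nbrs[of p] by simp
    qed
    ultimately show ?thesis
      unfolding checkerboard_weight.gain_def[OF w]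
      by (simp add: weight_def sum_subtractf sum_distrib_left)
  qed
  finally show ?thesis .
qed

lemma energy_infinite:
  assumes \<phi>: "absolute_norm \<phi>" and \<alpha>: "\<alpha> > 0" and J: "infinite J" "(0, 0) \<in> J"
    and per: "finite_perimeter (squares_union (pt ` J))"
  shows "energy \<phi> \<alpha> (squares_union (pt ` J)) (unit_square 0) = \<infinity>"
proof -
  note \<phi>D = absolute_normD[OF \<phi>]
  define m where "m = min (\<phi> (pt (1, 0))) (\<phi> (pt (0, 1)))"
  have nz: "\<phi> (pt p) \<noteq> 0" if "p \<noteq> (0, 0)" for p
    using that \<phi>D(2) pt_eq_iff[of p "(0, 0)"] unfolding pt_origin by simp
  have "0 < \<phi> (pt (1, 0))" "0 < \<phi> (pt (0, 1))"
    using nz[of "(1, 0)"] nz[of "(0, 1)"] \<phi>D(1)[of "pt (1, 0)"] \<phi>D(1)[of "pt (0, 1)"] by simp_all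
  then have m: "0 < m" by (simp add: m_def)
  have "m \<le> \<phi> (pt p)" if "p \<noteq> (0, 0)" for p
  proof -
    have "1 \<le> \<bar>fst p\<bar> \<or> 1 \<le> \<bar>snd p\<bar>" using that by (cases p) auto
    then have "\<phi> (pt (1, 0)) \<le> \<phi> (pt p) \<or> \<phi> (pt (0, 1)) \<le> \<phi> (pt p)"
      using absolute_norm_mono[OF \<phi>, of "pt (1, 0)" "pt p"] absolute_norm_mono[OF \<phi>, of "pt (0, 1)" "pt p"]
      by force
    then show ?thesis by (auto simp: m_def)
  qed
  then have "ennreal m \<le> boundary_dist \<phi> i (unit_square 0)" if "i \<in> pt ` (J - {(0, 0)})" for i
    using that by (elim imageE) (simp add: boundary_dist_origin ennreal_leI)
  moreover have "infinite (pt ` (J - {(0, 0)}))"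
    using J(1) by (simp add: finite_image_iff inj_on_def)
  ultimately have "(\<Sum>\<^sub>\<infinity>i\<in>pt ` (J - {(0, 0)}). boundary_dist \<phi> i (unit_square 0)) = \<infinity>"
    using m by (intro infsum_superconst_infinite_ennreal[of _ "ennreal m"]) simp_all
  moreover obtain h where "0 \<le> h" "hausdorff1 (frontier (squares_union (pt ` J))) = ennreal h"
    using per unfolding finite_perimeter_def by (cases "hausdorff1 (frontier (squares_union (pt ` J)))") auto
  ultimately show ?thesis
    unfolding energy_def sym_diff_centers[OF J(2)] using \<alpha> by (simp add: enn2ereal_ennreal)
qed

lemma convex_norm_ball:
  assumes "absolute_norm \<phi>"
  shows "convex (norm_ball \<phi> r)"
proof (rule convexI)
  fix x y and u v :: real
  assume xy: "x \<in> norm_ball \<phi> r" "y \<in> norm_ball \<phi> r" and uv: "0 \<le> u" "0 \<le> v" "u + v = 1"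
  have "u * \<phi> x + v * \<phi> y < r"
    using xy uv convex_bound_lt[of "\<phi> x" r "\<phi> y" u v] by (simp add: norm_ball_def)
  then show "u *\<^sub>R x + v *\<^sub>R y \<in> norm_ball \<phi> r"
    using absolute_norm_combination[OF assms uv(1,2), of x y] by (simp add: norm_ball_def)
qed

lemma even_ball_in_even_conv_sets:
  assumes "absolute_norm \<phi>"
  shows "squares_union (even_lattice2 \<inter> norm_ball \<phi> r) \<in> even_conv_sets"
proof -
  let ?I = "even_lattice2 \<inter> norm_ball \<phi> r"
  have "?I \<subseteq> range pt" unfolding even_lattice2_eq by blast
  then obtain J where J: "?I = pt ` J" by (auto simp: subset_image_iff)
  then have centers: "centers (squares_union ?I) = ?I" by simp
  have "squares_union ?I \<in> lattice_sets" using J lattice_sets_iff by auto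
  moreover have "convex hull ?I \<subseteq> norm_ball \<phi> r"
    using convex_norm_ball[OF assms] by (intro hull_minimal) auto
  then have "convex hull ?I \<inter> even_lattice2 = ?I"
    using hull_subset[of ?I convex] by blast
  ultimately show ?thesis unfolding even_conv_sets_def mem_Collect_eq centers by blast
qed

theorem proposition27:
  fixes \<phi> :: "real^2 \<Rightarrow> real" and \<alpha> :: real
  assumes "absolute_norm \<phi>" and "\<alpha> > 0" and "\<alpha> \<notin> critical_values \<phi>"
  shows "(\<exists>!E. first_step_solution \<phi> \<alpha> E) \<and>
    (\<forall>E. first_step_solution \<phi> \<alpha> E \<longrightarrow>
       E = squares_union (even_lattice2 \<inter> norm_ball \<phi> (4 / \<alpha>)) \<and> E \<in> even_conv_sets)"
proof -
  interpret checkerboard_weight "weight \<phi> \<alpha>"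
    using weight_checkerboard[OF assms] .
  let ?B = "squares_union (pt ` pos_even)"
  let ?en = "\<lambda>E. energy \<phi> \<alpha> E (unit_square 0)"
  let ?adm = "\<lambda>E. E \<in> lattice_sets \<and> finite_perimeter E \<and> unit_square 0 \<subseteq> E"
  have "even_lattice2 \<inter> norm_ball \<phi> (4 / \<alpha>) = pt ` pos_even"
    using assms(2) unfolding even_lattice2_eq pos_even_def
    by (auto simp: norm_ball_def weight_def pos_less_divide_eq mult.commute)
  then have B: "squares_union (even_lattice2 \<inter> norm_ball \<phi> (4 / \<alpha>)) = ?B" by simp
  have origin: "(0, 0) \<in> pos_even" using w_origin by (simp add: pos_even_def even_cell_def)
  have adm_B: "?adm ?B"
    using origin finite_pos_even hausdorff1_frontier[OF finite_pos_even]
    by (auto simp: lattice_sets_iff finite_perimeter_def ennreal_of_nat_eq_real_of_nat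
        unit_square_0 squares_union_def)
  have less: "?en ?B < ?en E" if E: "?adm E" and "E \<noteq> ?B" for E
  proof -
    obtain J where J: "E = squares_union (pt ` J)" using E lattice_sets_iff by blast
    have "pt (0, 0) \<in> unit_square (pt (0, 0))" by simp
    then have "pt (0, 0) \<in> E" using E by (auto simp: pt_origin)
    then have "(0, 0) \<in> J" by (auto simp: J squares_union_def)
    have en_B: "?en ?B = ereal (- gain pos_even)"
      using energy_finite[OF assms(1,2) finite_pos_even origin checkerboard_weight_axioms] .
    show ?thesis
    proof (cases "finite J")
      case True
      have "J \<noteq> pos_even" using \<open>E \<noteq> ?B\<close> J by blast
      then have "gain J < gain pos_even"
        using gain_le[OF True \<open>(0, 0) \<in> J\<close>] gain_pos_even by force
      then show ?thesis
        using energy_finite[OF assms(1,2) True \<open>(0, 0) \<in> J\<close> checkerboard_weight_axioms] en_B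
        by (simp add: J)
    next
      case False
      then show ?thesis
        using energy_infinite[OF assms(1,2) False \<open>(0, 0) \<in> J\<close>] E en_B by (simp add: J)
    qed
  qed
  have sol: "first_step_solution \<phi> \<alpha> E \<longleftrightarrow> E = ?B" for E
    unfolding first_step_solution_def is_arg_min_def using adm_B less by (metis less_asym)
  show ?thesis
    unfolding sol B using even_ball_in_even_conv_sets[OF assms(1), of "4 / \<alpha>"] B by simp
qed

end
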